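(* Let $k$ and $\ell$ be positive integers. Suppose that $\sigma \subseteq \mathbb{C}$ is a $k$-ray set and that $\tau \subseteq \mathbb{C}$ is an $\ell$-ray set. Then $AC(\sigma) \simeq AC(\tau)$ (isomorphic as Banach algebras) if and only if $k = \ell$.
   Context: Identify $\mathbb{C}$ with $\mathbb{R}^2$. Let $\sigma$ be a nonempty compact subset of the plane; all functions are complex-valued. Variation factor. Let $S=[x_0,x_1,\dots,x_n]$ be a finite ordered list of (not necessarily distinct) elements of $\sigma$, $n\ge 1$. For $f:\sigma\to\mathbb{C}$ put $\mathrm{cvar}(f,S)=\sum_{i=1}^n |f(x_i)-f(x_{i-1})|$. For a line $L$ in the plane, the segment from $x_i$ to $x_{i+1}$ ($0\le i\le n-1$) is a crossing segment of $S$ on $L$ if any one of the following holds: (i) $x_i$ and $x_{i+1}$ lie on strictly opposite sides of $L$; (ii) $i=0$ and $x_i\in L$; (iii) $i>0$, $x_i\in L$ and $x_{i-1}\notin L$; (iv) $i=n-1$, $x_i\notin L$ and $x_{i+1}\in L$. Let $\mathrm{vf}(S,L)$ be the number of indices $i$ giving a crossing segment of $S$ on $L$, and $\mathrm{vf}(S)=\max_L \mathrm{vf}(S,L)$ over all lines $L$. For a one-element list, $\mathrm{cvar}(f,[x_0])=0$ and $\mathrm{vf}([x_0])=1$. The spaces. $\mathrm{var}(f,\sigma)=\sup_S \mathrm{cvar}(f,S)/\mathrm{vf}(S)$, the supremum being over all finite ordered lists of elements of $\sigma$; $\|f\|_{BV(\sigma)}=\|f\|_\infty+\mathrm{var}(f,\sigma)$;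 $BV(\sigma)=\{f:\sigma\to\mathbb{C} : \|f\|_{BV(\sigma)}<\infty\}$, which is a Banach algebra under pointwise operations. $AC(\sigma)$ is the closure in $BV(\sigma)$ of the set of restrictions to $\sigma$ of complex polynomials $p(x,y)=\sum_{n,m}c_{nm}x^ny^m$ in two real variables; it is a closed subalgebra of $BV(\sigma)$. For Banach algebras $\mathcal{A},\mathcal{B}$, write $\mathcal{A}\simeq\mathcal{B}$ if there is a linear multiplicative bijection $\Phi:\mathcal{A}\to\mathcal{B}$ with $\Phi$ and $\Phi^{-1}$ continuous (not necessarily isometric). A $C$-set is a countably infinite compact subset of $\mathbb{C}$ with unique limit point $0$. For $\theta\in[0,2\pi)$ let $R_\theta=\{te^{i\theta}: t\ge 0\}$. For a positive integer $k$, a $C$-set $\sigma$ is a $k$-ray set if there are $k$ distinct rays $R_{\theta_1},\dots,R_{\theta_k}$ such that $\sigma_j:=\sigma\cap R_{\theta_j}$ is infinite for each $j=1,\dots,k$, and $\sigma_0:=\sigma\setminus(\sigma_1\cup\dots\cup\sigma_k)$ is finite. *)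

theory Defs
  imports "HOL-Analysis.Analysis"
begin

section \<open>Variation over a plane set\<close>

definition plane_line :: "complex set \<Rightarrow> bool" where
  "plane_line L \<longleftrightarrow> (\<exists>a b. a \<noteq> 0 \<and> L = {z. a \<bullet> z = b})"

text \<open>The two points lie in the two different open half-planes bounded by \<open>L\<close>. The roles of
  \<open>x\<close> and \<open>y\<close> are interchangeable, since \<open>(a, b)\<close> may be replaced by \<open>(- a, - b)\<close>.\<close>

definition opposite_sides :: "complex set \<Rightarrow> complex \<Rightarrow> complex \<Rightarrow> bool" where
  "opposite_sides L x y \<longleftrightarrow>
     (\<exists>a b. a \<noteq> 0 \<and> L = {z. a \<bullet> z = b} \<and> a \<bullet> x < b \<and> b < a \<bullet> y)"

text \<open>A list \<open>S = [x\<^sub>0, \<dots>, x\<^sub>n]\<close> has length \<open>n + 1\<close>, so \<open>Suc i < length S\<close> says \<open>i \<le> n - 1\<close> and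
  \<open>Suc (Suc i) = length S\<close> says \<open>i = n - 1\<close>.\<close>

definition crossing_segment :: "complex list \<Rightarrow> complex set \<Rightarrow> nat \<Rightarrow> bool" where
  "crossing_segment S L i \<longleftrightarrow> Suc i < length S \<and>
     (opposite_sides L (S ! i) (S ! Suc i) \<or>
      (i = 0 \<and> S ! i \<in> L) \<or>
      (i > 0 \<and> S ! i \<in> L \<and> S ! (i - 1) \<notin> L) \<or>
      (Suc (Suc i) = length S \<and> S ! i \<notin> L \<and> S ! Suc i \<in> L))"

definition vf_line :: "complex list \<Rightarrow> complex set \<Rightarrow> nat" where
  "vf_line S L = card {i. crossing_segment S L i}"

definition vf :: "complex list \<Rightarrow> nat" where
  "vf S = (if length S = 1 then 1 else Max {vf_line S L | L. plane_line L})"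

definition cvar :: "(complex \<Rightarrow> complex) \<Rightarrow> complex list \<Rightarrow> real" where
  "cvar f S = (\<Sum>i<length S - 1. norm (f (S ! Suc i) - f (S ! i)))"

definition var :: "complex set \<Rightarrow> (complex \<Rightarrow> complex) \<Rightarrow> ennreal" where
  "var \<sigma> f = (SUP S \<in> {S. S \<noteq> [] \<and> set S \<subseteq> \<sigma>}. ennreal (cvar f S / real (vf S)))"

section \<open>The algebras \<open>BV\<close> and \<open>AC\<close>\<close>

text \<open>A function \<open>\<sigma> \<rightarrow> \<complex>\<close> is represented by its extension by \<open>0\<close> to the whole plane. This makes
  equality of such functions equality in HOL, and the pointwise operations need no restriction.\<close>

definition functions_on :: "complex set \<Rightarrow> (complex \<Rightarrow> complex) set" where
  "functions_on \<sigma> = {f. \<forall>z. z \<notin> \<sigma> \<longrightarrow> f z = 0}"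

definition BV_enorm :: "complex set \<Rightarrow> (complex \<Rightarrow> complex) \<Rightarrow> ennreal" where
  "BV_enorm \<sigma> f = (SUP z \<in> \<sigma>. ennreal (norm (f z))) + var \<sigma> f"

definition BV :: "complex set \<Rightarrow> (complex \<Rightarrow> complex) set" where
  "BV \<sigma> = {f \<in> functions_on \<sigma>. BV_enorm \<sigma> f < \<infinity>}"

definition BV_norm :: "complex set \<Rightarrow> (complex \<Rightarrow> complex) \<Rightarrow> real" where
  "BV_norm \<sigma> f = enn2real (BV_enorm \<sigma> f)"

definition norm_topology ::
    "(complex \<Rightarrow> complex) set \<Rightarrow> ((complex \<Rightarrow> complex) \<Rightarrow> real) \<Rightarrow> (complex \<Rightarrow> complex) topology" where
  "norm_topology A N = Metric_space.mtopology A (\<lambda>f g. N (\<lambda>z. f z - g z))"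

definition polynomials_on :: "complex set \<Rightarrow> (complex \<Rightarrow> complex) set" where
  "polynomials_on \<sigma> =
     {\<lambda>z. if z \<in> \<sigma>
          then (\<Sum>n\<le>N. \<Sum>m\<le>N. c n m * complex_of_real (Re z) ^ n * complex_of_real (Im z) ^ m)
          else 0 | (N :: nat) (c :: nat \<Rightarrow> nat \<Rightarrow> complex). True}"

definition AC :: "complex set \<Rightarrow> (complex \<Rightarrow> complex) set" where
  "AC \<sigma> = norm_topology (BV \<sigma>) (BV_norm \<sigma>) closure_of polynomials_on \<sigma>"

section \<open>Isomorphism of Banach algebras of functions\<close>

text \<open>\<open>A\<close> and \<open>B\<close> are complex algebras of functions under the pointwise operations, with norms
  \<open>M\<close> and \<open>N\<close>.\<close>

definition banach_algebra_isomorphic ::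
    "(complex \<Rightarrow> complex) set \<Rightarrow> ((complex \<Rightarrow> complex) \<Rightarrow> real) \<Rightarrow>
     (complex \<Rightarrow> complex) set \<Rightarrow> ((complex \<Rightarrow> complex) \<Rightarrow> real) \<Rightarrow> bool" where
  "banach_algebra_isomorphic A M B N \<longleftrightarrow>
     (\<exists>\<Phi>. bij_betw \<Phi> A B \<and>
        (\<forall>f\<in>A. \<forall>g\<in>A. \<Phi> (\<lambda>z. f z + g z) = (\<lambda>z. \<Phi> f z + \<Phi> g z)) \<and>
        (\<forall>c. \<forall>f\<in>A. \<Phi> (\<lambda>z. c * f z) = (\<lambda>z. c * \<Phi> f z)) \<and>
        (\<forall>f\<in>A. \<forall>g\<in>A. \<Phi> (\<lambda>z. f z * g z) = (\<lambda>z. \<Phi> f z * \<Phi> g z)) \<and>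
        continuous_map (norm_topology A M) (norm_topology B N) \<Phi> \<and>
        continuous_map (norm_topology B N) (norm_topology A M) (inv_into A \<Phi>))"

definition AC_isomorphic :: "complex set \<Rightarrow> complex set \<Rightarrow> bool" where
  "AC_isomorphic \<sigma> \<tau> \<longleftrightarrow>
     banach_algebra_isomorphic (AC \<sigma>) (BV_norm \<sigma>) (AC \<tau>) (BV_norm \<tau>)"

section \<open>Ray sets\<close>

definition C_set :: "complex set \<Rightarrow> bool" where
  "C_set \<sigma> \<longleftrightarrow> countable \<sigma> \<and> infinite \<sigma> \<and> compact \<sigma> \<and> {z. z islimpt \<sigma>} = {0}"

definition ray :: "real \<Rightarrow> complex set" where
  "ray \<theta> = {complex_of_real t * cis \<theta> | t. t \<ge> 0}"

definition ray_set :: "nat \<Rightarrow> complex set \<Rightarrow> bool" where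
  "ray_set k \<sigma> \<longleftrightarrow> C_set \<sigma> \<and>
     (\<exists>\<theta> :: nat \<Rightarrow> real.
        (\<forall>j\<in>{1..k}. 0 \<le> \<theta> j \<and> \<theta> j < 2 * pi) \<and>
        inj_on (\<lambda>j. ray (\<theta> j)) {1..k} \<and>
        (\<forall>j\<in>{1..k}. infinite (\<sigma> \<inter> ray (\<theta> j))) \<and>
        finite (\<sigma> - (\<Union>j\<in>{1..k}. \<sigma> \<inter> ray (\<theta> j))))"

end

theory Submission
  imports Defs
begin

text \<open>
  The algebra \<open>AC \<sigma>\<close> of a \<open>k\<close>-ray set depends only on the combinatorics of \<open>k\<close> sequences converging to a
  common point. Arrange the nonzero points of \<open>\<sigma>\<close> in \<open>k\<close> sequences \<open>s j\<close>, one for each ray and with decreasing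
  modulus on it, and put the finitely many points off the rays in front of one of them. Then the \<open>BV\<close>
  norm of \<open>f\<close> is equivalent to the modulus of \<open>f 0\<close> plus the sum of all jumps
  \<open>norm (f (s j (Suc n)) - f (s j n))\<close>.

  One estimate holds because a monotone list on a ray has bounded variation factor, so the jumps are
  bounded by the variation (\<open>ray_norm_le\<close>). The other starts from half-planes: the indicator of a
  half-plane has variation at most 1 (\<open>var_le_halfplane\<close>). The set of points of a ray at distance at
  least \<open>r\<close> from the origin is an intersection of three half-planes, so its indicator has variation at
  most 3, whatever \<open>r\<close> is. Summation by parts writes \<open>f - f 0\<close> as a combination of such indicators, up
  to the finitely many points off the rays, with the increments of \<open>f\<close> as coefficients
  (\<open>BV_norm_le\<close>).

  In this norm the closure of the polynomials is easy to find: it consists of the functions with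
  summable jumps that converge along each sequence to their value at \<open>0\<close> (\<open>AC_iff_ray_regular\<close>). The one
  point that needs an argument is that indicators of isolated points are limits of polynomials; the
  powers of a quadratic peak function do it (\<open>indicator_AC\<close>). Two sets with the same number of rays
  therefore have isomorphic algebras: send the \<open>n\<close>-th point of the \<open>j\<close>-th sequence of one to the \<open>n\<close>-th
  point of the \<open>j\<close>-th sequence of the other (\<open>ray_enumeration_isomorphic\<close>).

  For the converse, an isomorphism carries minimal idempotents to minimal idempotents, and these are the
  indicators of nonzero points. The indicators of the initial segments of one sequence have bounded
  norms, hence so have their images. So the image of each sequence jumps in and out of each sequence of the other set
  only finitely often, and contains the tail of at least one of them. Images of different sequences
  are disjoint, so there are at least as many sequences on the other side
  (\<open>ray_enumeration_isomorphic_le\<close>); by symmetry the numbers are equal.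
\<close>

section \<open>Variation factors\<close>

lemma vf_line_le_length: "vf_line S L \<le> length S"
proof -
  have "{i. crossing_segment S L i} \<subseteq> {..<length S}"
    by (auto simp: crossing_segment_def)
  from card_mono[OF _ this] show ?thesis by (simp add: vf_line_def)
qed

lemma finite_vf_lines: "finite {vf_line S L | L. plane_line L}"
  by (rule finite_subset[of _ "{..length S}"]) (auto simp: vf_line_le_length)

lemma vf_line_le_vf:
  assumes "plane_line L"
  shows "vf_line S L \<le> vf S"
proof (cases "length S = 1")
  case True
  then have "{i. crossing_segment S L i} = {}" by (auto simp: crossing_segment_def)
  then show ?thesis by (simp add: vf_line_def)
next
  case False
  then show ?thesis
    using assms by (auto simp: vf_def intro!: Max_ge finite_vf_lines)
qed

lemma plane_line_hyperplane: "a \<noteq> 0 \<Longrightarrow> plane_line {z. a \<bullet> z = b}"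
  by (auto simp: plane_line_def)

lemma vf_le:
  assumes "\<And>L. plane_line L \<Longrightarrow> vf_line S L \<le> m" and "1 \<le> m"
  shows "vf S \<le> m"
proof (cases "length S = 1")
  case False
  have "plane_line {z. (1::complex) \<bullet> z = 0}" by (rule plane_line_hyperplane) simp
  then have "{vf_line S L | L. plane_line L} \<noteq> {}" by blast
  then show ?thesis
    using assms(1) False by (auto simp: vf_def finite_vf_lines)
qed (use assms in \<open>simp add: vf_def\<close>)

text \<open>A line through the first point of the list always produces a crossing segment.\<close>

lemma vf_pos:
  assumes "S \<noteq> []"
  shows "1 \<le> vf S"
proof (cases "length S = 1")
  case False
  define L where "L = {z::complex. 1 \<bullet> z = 1 \<bullet> S ! 0}"
  have "plane_line L" unfolding L_def by (rule plane_line_hyperplane) simp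
  have "Suc 0 < length S" using False assms by (cases S) (auto simp: Suc_lessI)
  then have "crossing_segment S L 0" by (simp add: crossing_segment_def L_def)
  moreover have "finite {i. crossing_segment S L i}"
    by (rule finite_subset[of _ "{..<length S}"]) (auto simp: crossing_segment_def)
  ultimately have "1 \<le> vf_line S L"
    by (auto simp: vf_line_def Suc_le_eq card_gt_0_iff)
  also have "\<dots> \<le> vf S" by (rule vf_line_le_vf) fact
  finally show ?thesis .
qed (simp add: vf_def)

section \<open>Bounds on the variation and the BV norm\<close>

text \<open>The bound \<open>var \<sigma> f \<le> c\<close>, freed of the division and of the extended reals so that sums of
  functions can be estimated one list at a time.\<close>

definition var_le :: "complex set \<Rightarrow> (complex \<Rightarrow> complex) \<Rightarrow> real \<Rightarrow> bool" where
  "var_le \<sigma> f c \<longleftrightarrow> (\<forall>S. S \<noteq> [] \<and> set S \<subseteq> \<sigma> \<longrightarrow> cvar f S \<le> c * real (vf S))"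

lemma cvar_nonneg: "0 \<le> cvar f S"
  by (simp add: cvar_def sum_nonneg)

lemma cvar_sum_le:
  assumes "\<And>x y. x \<in> set S \<Longrightarrow> y \<in> set S \<Longrightarrow>
             norm (f y - f x) \<le> norm (g y - g x) + norm (h y - h x)"
  shows "cvar f S \<le> cvar g S + cvar h S"
  unfolding cvar_def sum.distrib[symmetric] by (rule sum_mono) (auto intro!: assms nth_mem)

lemma cvar_add: "cvar (\<lambda>z. f z + g z) S \<le> cvar f S + cvar g S"
  by (rule cvar_sum_le) (metis add_diff_add norm_triangle_ineq)

lemma cvar_scale: "cvar (\<lambda>z. c * f z) S = norm c * cvar f S"
  by (simp add: cvar_def sum_distrib_left norm_mult flip: right_diff_distrib)

lemma BV_enorm_add: "BV_enorm \<sigma> (\<lambda>z. f z + g z) \<le> BV_enorm \<sigma> f + BV_enorm \<sigma> g"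
proof -
  have "(SUP z\<in>\<sigma>. ennreal (norm (f z + g z)))
      \<le> (SUP z\<in>\<sigma>. ennreal (norm (f z))) + (SUP z\<in>\<sigma>. ennreal (norm (g z)))"
  proof (rule SUP_least)
    fix z assume z: "z \<in> \<sigma>"
    have "ennreal (norm (f z + g z)) \<le> ennreal (norm (f z)) + ennreal (norm (g z))"
      by (simp add: norm_triangle_ineq flip: ennreal_plus)
    also have "\<dots> \<le> (SUP z\<in>\<sigma>. ennreal (norm (f z))) + (SUP z\<in>\<sigma>. ennreal (norm (g z)))"
      by (intro add_mono SUP_upper z)
    finally show "ennreal (norm (f z + g z)) \<le> \<dots>" .
  qed
  moreover have "var \<sigma> (\<lambda>z. f z + g z) \<le> var \<sigma> f + var \<sigma> g"
    unfolding var_def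
  proof (rule SUP_least)
    fix S assume S: "S \<in> {S. S \<noteq> [] \<and> set S \<subseteq> \<sigma>}"
    have "ennreal (cvar (\<lambda>z. f z + g z) S / real (vf S))
        \<le> ennreal (cvar f S / real (vf S)) + ennreal (cvar g S / real (vf S))"
      by (subst ennreal_plus[symmetric])
         (auto intro!: ennreal_leI divide_right_mono cvar_add
            simp: cvar_nonneg simp flip: add_divide_distrib)
    also have "\<dots> \<le> (SUP S\<in>{S. S \<noteq> [] \<and> set S \<subseteq> \<sigma>}. ennreal (cvar f S / real (vf S)))
       + (SUP S\<in>{S. S \<noteq> [] \<and> set S \<subseteq> \<sigma>}. ennreal (cvar g S / real (vf S)))"
      by (intro add_mono SUP_upper S)
    finally show "ennreal (cvar (\<lambda>z. f z + g z) S / real (vf S)) \<le> \<dots>" .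
  qed
  ultimately have "BV_enorm \<sigma> (\<lambda>z. f z + g z)
     \<le> ((SUP z\<in>\<sigma>. ennreal (norm (f z))) + (SUP z\<in>\<sigma>. ennreal (norm (g z)))) + (var \<sigma> f + var \<sigma> g)"
    unfolding BV_enorm_def by (rule add_mono)
  then show ?thesis by (simp add: BV_enorm_def add_ac)
qed

lemma BV_enorm_scale: "BV_enorm \<sigma> (\<lambda>z. c * f z) \<le> ennreal (norm c) * BV_enorm \<sigma> f"
proof -
  have "(SUP z\<in>\<sigma>. ennreal (norm (c * f z))) \<le> ennreal (norm c) * (SUP z\<in>\<sigma>. ennreal (norm (f z)))"
    by (rule SUP_least) (auto simp: norm_mult ennreal_mult intro!: mult_left_mono SUP_upper)
  moreover have "var \<sigma> (\<lambda>z. c * f z) \<le> ennreal (norm c) * var \<sigma> f"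
    unfolding var_def
    by (rule SUP_least)
       (auto simp: cvar_scale ennreal_mult cvar_nonneg simp flip: times_divide_eq_right
          intro!: mult_left_mono SUP_upper)
  ultimately show ?thesis by (simp add: BV_enorm_def distrib_left add_mono)
qed

lemma functions_on_add:
  "f \<in> functions_on \<sigma> \<Longrightarrow> g \<in> functions_on \<sigma> \<Longrightarrow> (\<lambda>z. f z + g z) \<in> functions_on \<sigma>"
  by (simp add: functions_on_def)

lemma functions_on_scale: "f \<in> functions_on \<sigma> \<Longrightarrow> (\<lambda>z. c * f z) \<in> functions_on \<sigma>"
  by (simp add: functions_on_def)

lemma BV_add:
  assumes "f \<in> BV \<sigma>" "g \<in> BV \<sigma>"
  shows "(\<lambda>z. f z + g z) \<in> BV \<sigma>"
    and "BV_norm \<sigma> (\<lambda>z. f z + g z) \<le> BV_norm \<sigma> f + BV_norm \<sigma> g"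
proof -
  have fin: "BV_enorm \<sigma> f + BV_enorm \<sigma> g < \<infinity>" using assms by (simp add: BV_def)
  with BV_enorm_add have "BV_enorm \<sigma> (\<lambda>z. f z + g z) < \<infinity>" by (rule le_less_trans)
  with assms show "(\<lambda>z. f z + g z) \<in> BV \<sigma>" by (simp add: BV_def functions_on_add)
  have "BV_norm \<sigma> (\<lambda>z. f z + g z) \<le> enn2real (BV_enorm \<sigma> f + BV_enorm \<sigma> g)"
    unfolding BV_norm_def using fin by (intro enn2real_mono BV_enorm_add) auto
  also have "\<dots> = BV_norm \<sigma> f + BV_norm \<sigma> g"
    using assms by (simp add: BV_def BV_norm_def enn2real_plus)
  finally show "BV_norm \<sigma> (\<lambda>z. f z + g z) \<le> BV_norm \<sigma> f + BV_norm \<sigma> g" .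
qed

lemma BV_scale:
  assumes "f \<in> BV \<sigma>"
  shows "(\<lambda>z. c * f z) \<in> BV \<sigma>"
    and "BV_norm \<sigma> (\<lambda>z. c * f z) \<le> norm c * BV_norm \<sigma> f"
proof -
  have fin: "ennreal (norm c) * BV_enorm \<sigma> f < \<infinity>"
    using assms by (simp add: BV_def ennreal_mult_less_top)
  with BV_enorm_scale have "BV_enorm \<sigma> (\<lambda>z. c * f z) < \<infinity>" by (rule le_less_trans)
  with assms show "(\<lambda>z. c * f z) \<in> BV \<sigma>" by (simp add: BV_def functions_on_scale)
  have "BV_norm \<sigma> (\<lambda>z. c * f z) \<le> enn2real (ennreal (norm c) * BV_enorm \<sigma> f)"
    unfolding BV_norm_def using fin by (intro enn2real_mono BV_enorm_scale) auto
  also have "\<dots> = norm c * BV_norm \<sigma> f"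
    by (simp add: BV_norm_def enn2real_mult)
  finally show "BV_norm \<sigma> (\<lambda>z. c * f z) \<le> norm c * BV_norm \<sigma> f" .
qed

lemma BV_diff:
  assumes "f \<in> BV \<sigma>" "g \<in> BV \<sigma>"
  shows "(\<lambda>z. f z - g z) \<in> BV \<sigma>"
    and "BV_norm \<sigma> (\<lambda>z. f z - g z) \<le> BV_norm \<sigma> f + BV_norm \<sigma> g"
  using BV_add[OF assms(1) BV_scale(1)[OF assms(2), of "- 1"]]
    BV_scale(2)[OF assms(2), of "- 1"] by simp_all

lemma BV_norm_nonneg: "0 \<le> BV_norm \<sigma> f"
  by (simp add: BV_norm_def)

lemma BV_I:
  assumes "f \<in> functions_on \<sigma>" and "\<And>z. z \<in> \<sigma> \<Longrightarrow> norm (f z) \<le> a" and "var_le \<sigma> f c"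
    and "0 \<le> a" and "0 \<le> c"
  shows "f \<in> BV \<sigma>" and "BV_norm \<sigma> f \<le> a + c"
proof -
  have "(SUP z\<in>\<sigma>. ennreal (norm (f z))) \<le> ennreal a"
    using assms(2) by (auto intro!: SUP_least ennreal_leI)
  moreover have "var \<sigma> f \<le> ennreal c"
    unfolding var_def
  proof (rule SUP_least)
    fix S assume S: "S \<in> {S. S \<noteq> [] \<and> set S \<subseteq> \<sigma>}"
    then have "0 < real (vf S)" using vf_pos[of S] by auto
    then have "cvar f S / real (vf S) \<le> c"
      using assms(3) S by (simp add: var_le_def pos_divide_le_eq)
    then show "ennreal (cvar f S / real (vf S)) \<le> ennreal c" by (rule ennreal_leI)
  qed
  ultimately have "BV_enorm \<sigma> f \<le> ennreal a + ennreal c"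
    unfolding BV_enorm_def by (rule add_mono)
  then have le: "BV_enorm \<sigma> f \<le> ennreal (a + c)" using assms by simp
  then have "BV_enorm \<sigma> f < \<infinity>" by (rule le_less_trans) simp
  with assms(1) show "f \<in> BV \<sigma>" by (simp add: BV_def)
  show "BV_norm \<sigma> f \<le> a + c"
    unfolding BV_norm_def using le assms by (intro enn2real_leI) auto
qed

lemma BV_D:
  assumes "f \<in> BV \<sigma>"
  shows "z \<in> \<sigma> \<Longrightarrow> norm (f z) \<le> BV_norm \<sigma> f" and "var_le \<sigma> f (BV_norm \<sigma> f)"
proof -
  have eq: "BV_enorm \<sigma> f = ennreal (BV_norm \<sigma> f)"
    using assms by (simp add: BV_def BV_norm_def)
  show "norm (f z) \<le> BV_norm \<sigma> f" if "z \<in> \<sigma>"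
  proof -
    have "ennreal (norm (f z)) \<le> (SUP z\<in>\<sigma>. ennreal (norm (f z)))"
      using that by (rule SUP_upper)
    also have "\<dots> \<le> BV_enorm \<sigma> f" by (simp add: BV_enorm_def)
    finally show ?thesis by (simp add: eq BV_norm_nonneg)
  qed
  show "var_le \<sigma> f (BV_norm \<sigma> f)"
    unfolding var_le_def
  proof (intro allI impI)
    fix S assume S: "S \<noteq> [] \<and> set S \<subseteq> \<sigma>"
    have "ennreal (cvar f S / real (vf S)) \<le> var \<sigma> f"
      unfolding var_def using S by (intro SUP_upper) auto
    also have "\<dots> \<le> BV_enorm \<sigma> f" by (simp add: BV_enorm_def)
    finally have "cvar f S / real (vf S) \<le> BV_norm \<sigma> f" by (simp add: eq BV_norm_nonneg)
    moreover have "0 < real (vf S)" using vf_pos[of S] S by auto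
    ultimately show "cvar f S \<le> BV_norm \<sigma> f * real (vf S)" by (simp add: pos_divide_le_eq)
  qed
qed

lemma Metric_space_BV: "Metric_space (BV \<sigma>) (\<lambda>f g. BV_norm \<sigma> (\<lambda>z. f z - g z))"
proof
  fix f g h
  show "0 \<le> BV_norm \<sigma> (\<lambda>z. f z - g z)" by (rule BV_norm_nonneg)
  have "cvar (\<lambda>z. f z - g z) S = cvar (\<lambda>z. g z - f z) S" for S
    using cvar_scale[of "- 1" "\<lambda>z. g z - f z"] by simp
  then show "BV_norm \<sigma> (\<lambda>z. f z - g z) = BV_norm \<sigma> (\<lambda>z. g z - f z)"
    by (simp add: BV_norm_def BV_enorm_def var_def norm_minus_commute)
  assume f: "f \<in> BV \<sigma>" and g: "g \<in> BV \<sigma>"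
  show "BV_norm \<sigma> (\<lambda>z. f z - g z) = 0 \<longleftrightarrow> f = g"
  proof
    assume *: "BV_norm \<sigma> (\<lambda>z. f z - g z) = 0"
    show "f = g"
    proof
      fix z show "f z = g z"
      proof (cases "z \<in> \<sigma>")
        case True
        from BV_D(1)[OF BV_diff(1)[OF f g] this] show ?thesis by (simp add: *)
      next
        case False
        with f g show ?thesis by (simp add: BV_def functions_on_def)
      qed
    qed
  next
    assume "f = g"
    moreover have "BV_norm \<sigma> (\<lambda>z. 0) \<le> 0 + 0"
      by (rule BV_I(2)) (auto simp: functions_on_def var_le_def cvar_def)
    ultimately show "BV_norm \<sigma> (\<lambda>z. f z - g z) = 0"
      using BV_norm_nonneg[of \<sigma> "\<lambda>z. 0"] by simp
  qed
  assume h: "h \<in> BV \<sigma>"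
  show "BV_norm \<sigma> (\<lambda>z. f z - h z) \<le> BV_norm \<sigma> (\<lambda>z. f z - g z) + BV_norm \<sigma> (\<lambda>z. g z - h z)"
    using BV_add(2)[OF BV_diff(1)[OF f g] BV_diff(1)[OF g h]] by simp
qed

lemma AC_iff:
  "f \<in> AC \<sigma> \<longleftrightarrow> f \<in> BV \<sigma> \<and>
     (\<forall>e>0. \<exists>p\<in>polynomials_on \<sigma> \<inter> BV \<sigma>. BV_norm \<sigma> (\<lambda>z. f z - p z) < e)"
proof -
  interpret Metric_space "BV \<sigma>" "\<lambda>f g. BV_norm \<sigma> (\<lambda>z. f z - g z)" by (rule Metric_space_BV)
  show ?thesis unfolding AC_def norm_topology_def metric_closure_of by auto
qed

lemma AC_subset_BV: "AC \<sigma> \<subseteq> BV \<sigma>"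
  by (auto simp: AC_iff)

lemma polynomials_subset_AC: "polynomials_on \<sigma> \<inter> BV \<sigma> \<subseteq> AC \<sigma>"
proof
  fix p assume p: "p \<in> polynomials_on \<sigma> \<inter> BV \<sigma>"
  have "BV_norm \<sigma> (\<lambda>z. p z - p z) = 0"
    using Metric_space.mdist_zero[OF Metric_space_BV, of p \<sigma>] p by simp
  with p show "p \<in> AC \<sigma>" unfolding AC_iff by force
qed

text \<open>\<open>AC\<close> being a closure, approximation by its members is as good as approximation by polynomials.\<close>

lemma AC_closed:
  assumes f: "f \<in> BV \<sigma>" and "\<And>e. 0 < e \<Longrightarrow> \<exists>g\<in>AC \<sigma>. BV_norm \<sigma> (\<lambda>z. f z - g z) < e"
  shows "f \<in> AC \<sigma>"
  unfolding AC_iff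
proof (intro conjI allI impI)
  fix e :: real assume "0 < e"
  then obtain g where g: "g \<in> AC \<sigma>" "BV_norm \<sigma> (\<lambda>z. f z - g z) < e / 2"
    using assms(2)[of "e / 2"] by auto
  then obtain p where p: "p \<in> polynomials_on \<sigma> \<inter> BV \<sigma>" "BV_norm \<sigma> (\<lambda>z. g z - p z) < e / 2"
    unfolding AC_iff using \<open>0 < e\<close> by (meson half_gt_zero)
  have "BV_norm \<sigma> (\<lambda>z. f z - p z)
      \<le> BV_norm \<sigma> (\<lambda>z. f z - g z) + BV_norm \<sigma> (\<lambda>z. g z - p z)"
    using Metric_space.triangle[OF Metric_space_BV] f g p AC_subset_BV by blast
  with g p show "\<exists>p\<in>polynomials_on \<sigma> \<inter> BV \<sigma>. BV_norm \<sigma> (\<lambda>z. f z - p z) < e" by force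
qed (rule f)

section \<open>Half-planes and ray tails\<close>

lemma var_le_mono: "var_le \<sigma> f c \<Longrightarrow> c \<le> d \<Longrightarrow> var_le \<sigma> f d"
  unfolding var_le_def by (meson mult_right_mono of_nat_0_le_iff order_trans)

lemma cvar_cong: "(\<And>z. z \<in> set S \<Longrightarrow> f z = g z) \<Longrightarrow> cvar f S = cvar g S"
  by (auto simp: cvar_def intro!: sum.cong)

lemma var_le_cong: "(\<And>z. z \<in> \<sigma> \<Longrightarrow> f z = g z) \<Longrightarrow> var_le \<sigma> f c = var_le \<sigma> g c"
  unfolding var_le_def by (metis cvar_cong subsetD)

text \<open>A list changes between the half-plane and its complement only across the boundary line. Moving
  that line slightly into the complement, so that it misses the finitely many points of the list,
  puts the end points of each changing segment strictly on opposite sides of it, so that \<open>vf\<close> counts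
  all of these segments.\<close>

lemma var_le_halfplane:
  assumes "a \<noteq> 0"
  shows "var_le \<sigma> (indicator {z. b \<le> a \<bullet> z}) 1"
  unfolding var_le_def
proof (intro allI impI)
  fix S :: "complex list"
  let ?f = "indicator {z. b \<le> a \<bullet> z} :: complex \<Rightarrow> complex"
  define M where "M = Max (insert (b - 1) ((\<lambda>z. a \<bullet> z) ` (set S \<inter> {z. a \<bullet> z < b})))"
  have "M < b" unfolding M_def by (subst Max_less_iff) auto
  have M: "a \<bullet> z \<le> M" if "z \<in> set S" "a \<bullet> z < b" for z
    unfolding M_def using that by (intro Max_ge) auto
  \<comment> \<open>the shifted boundary: below \<open>b\<close>, above every value below \<open>b\<close> that occurs in the list\<close>
  define c where "c = (M + b) / 2"
  have c: "c < b" "\<And>z. z \<in> set S \<Longrightarrow> a \<bullet> z < b \<Longrightarrow> a \<bullet> z < c"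
    using \<open>M < b\<close> M by (force simp: c_def)+
  define L where "L = {z. a \<bullet> z = c}"
  have L': "L = {z. (- a) \<bullet> z = - c}" by (simp add: L_def)
  have cross: "crossing_segment S L i"
    if i: "i < length S - 1" and ne: "?f (S ! Suc i) \<noteq> ?f (S ! i)" for i
  proof -
    have mem: "S ! i \<in> set S" "S ! Suc i \<in> set S" using i by auto
    have "opposite_sides L (S ! i) (S ! Suc i)"
    proof (cases "b \<le> a \<bullet> S ! i")
      case True
      then have "a \<bullet> S ! Suc i < c" using ne c mem by (auto simp: indicator_def split: if_splits)
      then show ?thesis
        unfolding opposite_sides_def using L' True c assms
        by (intro exI[of _ "- a"] exI[of _ "- c"]) auto
    next
      case False
      then have "b \<le> a \<bullet> S ! Suc i" using ne by (auto simp: indicator_def split: if_splits)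
      then show ?thesis
        unfolding opposite_sides_def using L_def False c mem assms
        by (intro exI[of _ "a"] exI[of _ "c"]) auto
    qed
    then show ?thesis using i by (auto simp: crossing_segment_def)
  qed
  have "cvar ?f S \<le> (\<Sum>i<length S - 1. if crossing_segment S L i then 1 else 0)"
    unfolding cvar_def
  proof (rule sum_mono)
    fix i assume i: "i \<in> {..<length S - 1}"
    show "norm (?f (S ! Suc i) - ?f (S ! i)) \<le> (if crossing_segment S L i then 1 else 0)"
    proof (cases "?f (S ! Suc i) = ?f (S ! i)")
      case False
      with cross i show ?thesis by (auto simp: indicator_def)
    qed auto
  qed
  also have "\<dots> = real (card ({..<length S - 1} \<inter> {i. crossing_segment S L i}))"
    by (simp add: sum.If_cases)
  also have "{..<length S - 1} \<inter> {i. crossing_segment S L i} = {i. crossing_segment S L i}"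
    by (auto simp: crossing_segment_def)
  also have "real (card {i. crossing_segment S L i}) \<le> real (vf S)"
    using vf_line_le_vf[of L S] assms by (simp add: vf_line_def L_def plane_line_hyperplane)
  finally show "cvar ?f S \<le> 1 * real (vf S)" by simp
qed

lemma var_le_Int:
  assumes "var_le \<sigma> (indicator A) c" "var_le \<sigma> (indicator B) d"
  shows "var_le \<sigma> (indicator (A \<inter> B)) (c + d)"
  unfolding var_le_def
proof (intro allI impI)
  fix S assume S: "S \<noteq> [] \<and> set S \<subseteq> \<sigma>"
  have "cvar (indicator (A \<inter> B)) S \<le> cvar (indicator A) S + cvar (indicator B) S"
    by (rule cvar_sum_le) (auto simp: indicator_def)
  also have "\<dots> \<le> (c + d) * real (vf S)"
    using assms S by (auto simp: var_le_def distrib_right intro: add_mono)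
  finally show "cvar (indicator (A \<inter> B)) S \<le> (c + d) * real (vf S)" .
qed

lemma var_le_Un:
  assumes "var_le \<sigma> (indicator A) c" "var_le \<sigma> (indicator B) d"
  shows "var_le \<sigma> (indicator (A \<union> B)) (c + d)"
  unfolding var_le_def
proof (intro allI impI)
  fix S assume S: "S \<noteq> [] \<and> set S \<subseteq> \<sigma>"
  have "cvar (indicator (A \<union> B)) S \<le> cvar (indicator A) S + cvar (indicator B) S"
    by (rule cvar_sum_le) (auto simp: indicator_def)
  also have "\<dots> \<le> (c + d) * real (vf S)"
    using assms S by (auto simp: var_le_def distrib_right intro: add_mono)
  finally show "cvar (indicator (A \<union> B)) S \<le> (c + d) * real (vf S)" .
qed

lemma mem_ray_iff: "z \<in> ray \<theta> \<longleftrightarrow> z = complex_of_real (norm z) * cis \<theta>"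
  by (auto simp: ray_def norm_mult intro: exI[of _ "norm z"])

text \<open>The tail is an intersection of three half-planes: two of them cut out the line that carries the
  ray, the third, perpendicular to it, removes the points close to the origin. The bound does not
  depend on \<open>r\<close>, and this uniformity is what makes the upper estimate of the norm possible.\<close>

lemma var_le_ray_tail:
  assumes "0 < r"
  shows "var_le \<sigma> (indicator {z \<in> ray \<theta>. r \<le> norm z}) 3"
proof -
  let ?n = "\<i> * cis \<theta>"
  have "{z \<in> ray \<theta>. r \<le> norm z}
      = {z. 0 \<le> ?n \<bullet> z} \<inter> ({z. 0 \<le> (- ?n) \<bullet> z} \<inter> {z. r \<le> cis \<theta> \<bullet> z})" (is "?A = ?B")
  proof
    show "?A \<subseteq> ?B"
    proof
      fix z assume "z \<in> ?A"
      then obtain t where t: "z = complex_of_real t * cis \<theta>" "0 \<le> t" and "r \<le> norm z"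
        by (auto simp: ray_def)
      have inner: "cos \<theta> * (t * cos \<theta>) + sin \<theta> * (t * sin \<theta>) = t" for t
        using sin_cos_squared_add3[of \<theta>]
        by (metis distrib_left mult.left_commute mult.right_neutral)
      have "norm z = t" using t by (simp add: norm_mult)
      then have "r \<le> t" using \<open>r \<le> norm z\<close> by simp
      moreover have "Re z = t * cos \<theta>" "Im z = t * sin \<theta>" by (simp_all add: t(1))
      ultimately show "z \<in> ?B" by (simp add: inner_complex_def inner)
    qed
    show "?B \<subseteq> ?A"
    proof
      fix z assume z: "z \<in> ?B"
      define t where "t = cis \<theta> \<bullet> z"
      have 0: "cos \<theta> * Im z = sin \<theta> * Re z" and "r \<le> t"
        using z by (auto simp: inner_complex_def t_def)
      have "t * cos \<theta> = Re z * (cos \<theta> * cos \<theta>) + sin \<theta> * (cos \<theta> * Im z)"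
        by (simp add: t_def inner_complex_def algebra_simps)
      also have "\<dots> = Re z * (cos \<theta> * cos \<theta> + sin \<theta> * sin \<theta>)"
        unfolding 0 by (simp only: algebra_simps)
      finally have re: "t * cos \<theta> = Re z" by (simp only: sin_cos_squared_add3 mult_1_right)
      have "t * sin \<theta> = cos \<theta> * (sin \<theta> * Re z) + Im z * (sin \<theta> * sin \<theta>)"
        by (simp add: t_def inner_complex_def algebra_simps)
      also have "\<dots> = Im z * (cos \<theta> * cos \<theta> + sin \<theta> * sin \<theta>)"
        unfolding 0[symmetric] by (simp only: algebra_simps)
      finally have im: "t * sin \<theta> = Im z" by (simp only: sin_cos_squared_add3 mult_1_right)
      have "z = complex_of_real t * cis \<theta>" using re im by (simp add: complex_eq_iff)
      moreover from this have "norm z = t" using \<open>r \<le> t\<close> assms by (simp add: norm_mult)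
      ultimately show "z \<in> ?A" using \<open>r \<le> t\<close> assms by (auto simp: ray_def)
    qed
  qed
  moreover have "var_le \<sigma> (indicator ?B) (1 + (1 + 1))"
    by (intro var_le_Int var_le_halfplane) auto
  ultimately show ?thesis by simp
qed

text \<open>A point is an intersection of four half-planes.\<close>

lemma var_le_finite:
  assumes "finite F"
  shows "var_le \<sigma> (indicator F) (4 * real (card F))"
  using assms
proof induction
  case empty
  show ?case by (simp add: var_le_def cvar_def)
next
  case (insert p F)
  have "{p} = {z. Re p \<le> 1 \<bullet> z} \<inter> ({z. - Re p \<le> (- 1) \<bullet> z} \<inter>
      ({z. Im p \<le> \<i> \<bullet> z} \<inter> {z. - Im p \<le> (- \<i>) \<bullet> z}))"
    by (auto simp: inner_complex_def complex_eq_iff)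
  moreover have "var_le \<sigma> (indicator \<dots>) (1 + (1 + (1 + 1)))"
    by (intro var_le_Int var_le_halfplane) auto
  ultimately have "var_le \<sigma> (indicator {p}) 4" by simp
  from var_le_Un[OF this insert.IH] insert.hyps show ?case by (simp add: algebra_simps)
qed

section \<open>Monotone lists on a line\<close>

text \<open>\<open>opposite_sides\<close> chooses its own equation of the line. A given equation \<open>a \<bullet> z = b\<close> changes sign
  as well, because the segment from \<open>x\<close> to \<open>y\<close> meets the line in an interior point.\<close>

lemma opposite_sides_mult_nonpos:
  assumes "opposite_sides {z. a \<bullet> z = b} x y"
  shows "(a \<bullet> x - b) * (a \<bullet> y - b) \<le> 0"
proof -
  obtain a' b' where eq: "{z. a \<bullet> z = b} = {z. a' \<bullet> z = b'}" and *: "a' \<bullet> x < b'" "b' < a' \<bullet> y"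
    using assms by (auto simp: opposite_sides_def)
  define u where "u = (b' - a' \<bullet> x) / (a' \<bullet> y - a' \<bullet> x)"
  have u: "0 < u" "u < 1" using * by (auto simp: u_def)
  have "u * (a' \<bullet> y - a' \<bullet> x) = b' - a' \<bullet> x" using * by (simp add: u_def)
  then have "a' \<bullet> (x + u *\<^sub>R (y - x)) = b'" by (simp add: inner_right_distrib inner_diff_right)
  with eq have "a \<bullet> (x + u *\<^sub>R (y - x)) = b" by blast
  then have "(1 - u) * (a \<bullet> x - b) = - u * (a \<bullet> y - b)"
    by (simp add: inner_right_distrib inner_diff_right algebra_simps)
  then have "(1 - u) * ((a \<bullet> x - b) * (a \<bullet> y - b)) = - u * ((a \<bullet> y - b) * (a \<bullet> y - b))"
    by (metis mult.assoc)
  also have "\<dots> \<le> 0" using u by simp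
  finally show ?thesis using u by (simp add: mult_le_0_iff)
qed

lemma sign_changes_strict_mono:
  fixes h :: "nat \<Rightarrow> real"
  assumes "strict_mono h"
  obtains m where "{i. h i * h (Suc i) \<le> 0} \<subseteq> {m, Suc m}"
proof (cases "\<exists>i. h i * h (Suc i) \<le> 0")
  case True
  define m where "m = (LEAST i. h i * h (Suc i) \<le> 0)"
  have m: "h m * h (Suc m) \<le> 0" unfolding m_def using True by (rule LeastI_ex)
  have sign: "h i \<le> 0 \<and> 0 \<le> h (Suc i)" if "h i * h (Suc i) \<le> 0" for i
    using that strict_monoD[OF assms, of i "Suc i"] by (auto simp: mult_le_0_iff)
  have "i = m \<or> i = Suc m" if i: "h i * h (Suc i) \<le> 0" for i
  proof (rule ccontr)
    assume "\<not> ?thesis"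
    moreover have "m \<le> i" unfolding m_def using i by (rule Least_le)
    ultimately have "h (Suc m) < h i" by (intro strict_monoD[OF assms]) auto
    with sign[OF m] sign[OF i] show False by simp
  qed
  then have "{i. h i * h (Suc i) \<le> 0} \<subseteq> {m, Suc m}" by auto
  then show thesis by (rule that)
qed (auto intro: that)

text \<open>An affine function is either constant or strictly monotone along the list. If it is strictly
  monotone, it vanishes or changes sign on a crossing segment, which happens on one segment, or on
  two neighbouring ones if a point of the list lies on the line. If it is constant, all points lie on
  the line and only the first segment counts, or no point does and none counts. The sharp bound is
  1; any constant serves here.\<close>

lemma vf_monotone_collinear:
  assumes t: "\<And>m n. m < n \<Longrightarrow> t n < (t m :: real)"
  shows "vf (map (\<lambda>n. complex_of_real (t n) * w) [0..<N]) \<le> 2" (is "vf ?S \<le> 2")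
proof (rule vf_le)
  fix L assume "plane_line L"
  then obtain a b where L: "L = {z. a \<bullet> z = b}" by (auto simp: plane_line_def)
  define h where "h n = a \<bullet> (complex_of_real (t n) * w) - b" for n
  have h: "h n = t n * (a \<bullet> w) - b" for n
    by (simp add: h_def inner_complex_def algebra_simps)
  have len: "length ?S = N" by simp
  have nth: "?S ! i \<in> L \<longleftrightarrow> h i = 0" if "i < N" for i using that by (simp add: L h_def)
  have cross: "h i * h (Suc i) \<le> 0" if "crossing_segment ?S L i" for i
  proof -
    have i: "Suc i < N" using that by (simp add: crossing_segment_def)
    have "opposite_sides L (?S ! i) (?S ! Suc i) \<or> ?S ! i \<in> L \<or> ?S ! Suc i \<in> L"
      using that unfolding crossing_segment_def by blast
    then consider "opposite_sides L (?S ! i) (?S ! Suc i)" | "h i = 0" | "h (Suc i) = 0"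
      using nth[of i] nth[of "Suc i"] i by auto
    then show ?thesis
    proof cases
      case 1
      then show ?thesis using opposite_sides_mult_nonpos[of a b "?S ! i" "?S ! Suc i"] i
        by (simp add: L h_def)
    qed simp_all
  qed
  have two: "vf_line ?S L \<le> 2" if "strict_mono g" "\<And>i. g i * g (Suc i) = h i * h (Suc i)" for g
  proof -
    obtain m where m: "{i. g i * g (Suc i) \<le> 0} \<subseteq> {m, Suc m}"
      using sign_changes_strict_mono \<open>strict_mono g\<close> by blast
    have "{i. crossing_segment ?S L i} \<subseteq> {i. g i * g (Suc i) \<le> 0}"
      using cross that(2) by auto
    with m have "{i. crossing_segment ?S L i} \<subseteq> {m, Suc m}" by blast
    then have "vf_line ?S L \<le> card {m, Suc m}" unfolding vf_line_def by (intro card_mono) auto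
    then show ?thesis by simp
  qed
  show "vf_line ?S L \<le> 2"
  proof (cases "a \<bullet> w = 0")
    case True
    have "i = 0" if "crossing_segment ?S L i" for i
    proof -
      have "b * b \<le> 0" using cross[OF that] True by (simp add: h)
      then have "h n = 0" for n using True by (auto simp: h mult_le_0_iff)
      then have in_L: "?S ! n \<in> L" if "n < N" for n using nth that by simp
      moreover have "Suc i < N" using that by (simp add: crossing_segment_def)
      ultimately have "?S ! i \<in> L" "?S ! Suc i \<in> L" "?S ! (i - 1) \<in> L" by auto
      with that show ?thesis unfolding crossing_segment_def opposite_sides_def by auto
    qed
    then have "{i. crossing_segment ?S L i} \<subseteq> {0}" by auto
    then have "vf_line ?S L \<le> card {0::nat}" unfolding vf_line_def by (intro card_mono) auto
    then show ?thesis by simp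
  next
    case False
    define g where "g n = - sgn (a \<bullet> w) * h n" for n
    show ?thesis
    proof (rule two[of g])
      show "g i * g (Suc i) = h i * h (Suc i)" for i
        using False by (auto simp: g_def sgn_if)
      show "strict_mono g"
      proof (rule strict_monoI)
        fix i j :: nat assume "i < j"
        then have "t j < t i" by (rule t)
        then have "\<bar>a \<bullet> w\<bar> * t j < \<bar>a \<bullet> w\<bar> * t i" using False by simp
        then show "g i < g j" by (auto simp: g_def h sgn_if abs_if algebra_simps split: if_splits)
      qed
    qed
  qed
qed simp

section \<open>Enumerating points along a ray\<close>

text \<open>An element is numbered by how many elements have a larger value. The numbers that occur are closed
  downwards, since the element just above one of rank \<open>m + 1\<close> has rank \<open>m\<close>.\<close>

lemma decreasing_enumeration:
  fixes g :: "'a \<Rightarrow> real"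
  assumes inf: "infinite P" and inj: "inj_on g P" and fin: "\<And>z. z \<in> P \<Longrightarrow> finite {w\<in>P. g z < g w}"
  shows "\<exists>s. bij_betw s (UNIV :: nat set) P \<and> (\<forall>m n. m < n \<longrightarrow> g (s n) < g (s m))"
proof -
  define rank where "rank z = card {w\<in>P. g z < g w}" for z
  have anti: "rank y < rank x" if "x \<in> P" "y \<in> P" "g x < g y" for x y
    unfolding rank_def
  proof (rule psubset_card_mono)
    show "{w\<in>P. g y < g w} \<subset> {w\<in>P. g x < g w}" using that by fastforce
  qed (use that fin in auto)
  have inj': "inj_on rank P"
  proof (rule inj_onI)
    fix x y assume xy: "x \<in> P" "y \<in> P" "rank x = rank y"
    then have "g x = g y" using anti[of x y] anti[of y x] by force
    with xy inj show "x = y" by (auto dest: inj_onD)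
  qed
  have down: "m \<in> rank ` P" if m: "Suc m \<in> rank ` P" for m
  proof -
    obtain z where z: "z \<in> P" "rank z = Suc m" using m by auto
    define W where "W = {w\<in>P. g z < g w}"
    have W: "finite W" "card W = Suc m" using z fin by (auto simp: W_def rank_def)
    then have "W \<noteq> {}" by auto
    define y where "y = arg_min_on g W"
    have y: "y \<in> W" "\<And>w. w \<in> W \<Longrightarrow> g y \<le> g w"
      unfolding y_def using W \<open>W \<noteq> {}\<close> by (auto intro: arg_min_if_finite(1) arg_min_least)
    have "{w\<in>P. g y < g w} = W - {y}"
    proof
      show "W - {y} \<subseteq> {w\<in>P. g y < g w}"
      proof
        fix w assume w: "w \<in> W - {y}"
        then have "g y \<le> g w" "g y \<noteq> g w" using y inj by (auto simp: W_def dest: inj_onD)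
        with w show "w \<in> {w\<in>P. g y < g w}" by (auto simp: W_def)
      qed
    qed (use y in \<open>auto simp: W_def\<close>)
    then have "rank y = m" using W y by (simp add: rank_def)
    with y show ?thesis by (auto simp: W_def)
  qed
  have "rank ` P = UNIV"
  proof (intro set_eqI iffI UNIV_I)
    fix m :: nat
    have "infinite (rank ` P)" using inf inj' by (simp add: finite_image_iff)
    then obtain n where "m < n" "n \<in> rank ` P" unfolding infinite_nat_iff_unbounded by blast
    then have "m \<le> n" by simp
    then show "m \<in> rank ` P" using \<open>n \<in> rank ` P\<close>
      by (induction rule: inc_induct) (simp_all add: down)
  qed
  with inj' have bij: "bij_betw rank P UNIV" by (simp add: bij_betw_def)
  define s where "s = inv_into P rank"
  have s: "s n \<in> P" "rank (s n) = n" for n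
    using bij_betw_inv_into_right[OF bij, of n] bij_betw_apply[OF bij_betw_inv_into[OF bij], of n]
    by (auto simp: s_def)
  show ?thesis
  proof (intro exI conjI allI impI)
    show "bij_betw s UNIV P" unfolding s_def using bij by (rule bij_betw_inv_into)
    fix m n :: nat assume "m < n"
    show "g (s n) < g (s m)"
    proof (rule ccontr)
      assume "\<not> ?thesis"
      then consider "g (s m) < g (s n)" | "s m = s n"
        using inj s by (auto simp: not_less le_less dest: inj_onD)
      then show False
      proof cases
        case 1
        from anti[OF s(1) s(1) this] \<open>m < n\<close> show False by (simp add: s(2))
      next
        case 2
        then have "m = n" using s(2) by metis
        with \<open>m < n\<close> show False by simp
      qed
    qed
  qed
qed

lemma C_set_finite_away:
  assumes "C_set \<sigma>" "0 < r"
  shows "finite {z\<in>\<sigma>. r \<le> norm z}"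
proof (rule ccontr)
  assume inf: "infinite {z\<in>\<sigma>. r \<le> norm z}"
  have "{z\<in>\<sigma>. r \<le> norm z} = \<sigma> \<inter> {z. r \<le> norm z}" by auto
  then have "compact {z\<in>\<sigma>. r \<le> norm z}"
    using assms by (auto simp: C_set_def intro!: compact_Int_closed closed_Collect_le continuous_intros)
  then obtain x where x: "x \<in> {z\<in>\<sigma>. r \<le> norm z}" "x islimpt {z\<in>\<sigma>. r \<le> norm z}"
    using Heine_Borel_imp_Bolzano_Weierstrass inf by blast
  then have "x islimpt \<sigma>" by (auto elim: islimpt_subset)
  with assms(1) have "x = 0" by (auto simp: C_set_def)
  with x assms(2) show False by simp
qed

lemma C_set_zero_mem: "C_set \<sigma> \<Longrightarrow> 0 \<in> \<sigma>"
  unfolding C_set_def by (metis closed_limpt compact_imp_closed mem_Collect_eq singletonI)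

text \<open>Any nonzero point determines its ray, so distinct rays meet only in \<open>0\<close>.\<close>

lemma ray_eq:
  assumes "z \<in> ray \<theta>" "z \<noteq> 0"
  shows "ray \<theta> = {complex_of_real t * sgn z | t. 0 \<le> t}"
proof -
  have "z = complex_of_real (norm z) * cis \<theta>" using assms by (simp add: mem_ray_iff)
  then have "sgn z = cis \<theta>" using assms(2)
    by (metis norm_eq_zero nonzero_mult_div_cancel_left of_real_eq_0_iff sgn_eq)
  then show ?thesis by (simp add: ray_def)
qed

lemma zero_mem_ray: "0 \<in> ray \<theta>"
  by (auto simp: ray_def)

text \<open>The finitely many points of \<open>F\<close> are listed first, then those of the ray with decreasing modulus. An
  initial segment of the sequence is then part of \<open>F\<close>, or \<open>F\<close> together with a ray tail, so its
  indicator has variation bounded independently of its length. Conversely, a stretch of the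
  sequence on the ray is a monotone list with small variation factor, so the jumps of \<open>f\<close> along it
  are controlled by \<open>BV_norm \<sigma> f\<close>; the jumps between points of \<open>F\<close> are controlled by the supremum.\<close>

lemma ray_sequence:
  assumes \<sigma>: "C_set \<sigma>" and inf: "infinite (\<sigma> \<inter> ray \<theta>)"
    and F: "finite F" "F \<inter> ray \<theta> = {}" "F \<subseteq> \<sigma>"
  shows "\<exists>s C. bij_betw s (UNIV :: nat set) (F \<union> (\<sigma> \<inter> ray \<theta> - {0})) \<and> s \<longlonglongrightarrow> 0 \<and>
    summable (\<lambda>n. norm (s (Suc n) - s n)) \<and> 0 \<le> C \<and>
    (\<forall>f\<in>BV \<sigma>. \<forall>N. (\<Sum>n<N. norm (f (s (Suc n)) - f (s n))) \<le> C * BV_norm \<sigma> f) \<and>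
    (\<forall>n. var_le \<sigma> (indicator (s ` {..n})) C)"
proof -
  let ?R = "\<sigma> \<inter> ray \<theta> - {0}"
  have away: "finite {z\<in>\<sigma>. e \<le> norm z}" if "0 < e" for e
    using \<sigma> that by (rule C_set_finite_away)
  have "infinite ?R" using inf by simp
  moreover have "inj_on norm ?R"
    by (rule inj_onI) (metis DiffD1 IntD2 mem_ray_iff)
  moreover have "finite {w \<in> ?R. norm z < norm w}" if "z \<in> ?R" for z
    by (rule finite_subset[OF _ away[of "norm z"]]) (use that in auto)
  ultimately have "\<exists>r. bij_betw r (UNIV::nat set) ?R \<and> (\<forall>m n. m < n \<longrightarrow> norm (r n) < norm (r m))"
    by (rule decreasing_enumeration)
  then obtain r where r: "bij_betw r (UNIV::nat set) ?R"
    and dec: "\<And>m n. m < n \<Longrightarrow> norm (r n) < norm (r m)"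
    by blast
  have rmem: "r n \<in> \<sigma>" "r n \<in> ray \<theta>" "r n \<noteq> 0" for n
    using bij_betw_apply[OF r, of n] by auto
  have r0: "r \<longlonglongrightarrow> 0"
  proof (rule LIMSEQ_I)
    fix e :: real assume "0 < e"
    have "infinite (range r)" using \<open>infinite ?R\<close> r by (simp add: bij_betw_def)
    then have "\<not> range r \<subseteq> {z\<in>\<sigma>. e \<le> norm z}" using away[OF \<open>0 < e\<close>] finite_subset by blast
    then obtain m where "r m \<notin> {z\<in>\<sigma>. e \<le> norm z}" by blast
    then have m: "norm (r m) < e" using rmem(1) by simp
    then have "norm (r n - 0) < e" if "m \<le> n" for n
      using dec[of m n] m that by (cases "m = n") auto
    then show "\<exists>m. \<forall>n\<ge>m. norm (r n - 0) < e" by blast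
  qed
  have "norm (r (Suc n) - r n) = norm (r n) - norm (r (Suc n))" for n
  proof -
    have "r (Suc n) - r n = complex_of_real (norm (r (Suc n)) - norm (r n)) * cis \<theta>"
      using rmem(2)[of n] rmem(2)[of "Suc n"] by (simp add: mem_ray_iff left_diff_distrib)
    then have "norm (r (Suc n) - r n) = \<bar>norm (r (Suc n)) - norm (r n)\<bar>"
      by (simp add: norm_mult del: of_real_diff)
    with dec[of n "Suc n"] show ?thesis by simp
  qed
  then have rsum: "summable (\<lambda>n. norm (r (Suc n) - r n))"
    using telescope_summable'[OF tendsto_norm_zero[OF r0]] by simp
  define a where "a = card F"
  obtain e where e: "bij_betw e {..<a} F"
    using ex_bij_betw_nat_finite[OF F(1)] by (auto simp: a_def atLeast0LessThan)
  define s where "s n = (if n < a then e n else r (n - a))" for n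
  have sr: "s (n + a) = r n" for n by (simp add: s_def)
  have sF: "s ` {..<a} = F" using e by (auto simp: s_def bij_betw_def)
  define C where "C = 4 * real a + 3"
  show ?thesis
  proof (rule exI[of _ s], rule exI[of _ C], intro conjI allI ballI)
    have "bij_betw s {..<a} F" using e by (subst bij_betw_cong[of _ s e]) (auto simp: s_def)
    moreover have "bij_betw s {a..} ?R"
    proof -
      have "bij_betw (\<lambda>n. n - a) {a..} UNIV"
        by (rule bij_betwI[of _ _ _ "\<lambda>n. n + a"]) auto
      from bij_betw_trans[OF this r] show ?thesis
        by (subst bij_betw_cong[of _ s "r \<circ> (\<lambda>n. n - a)"]) (auto simp: s_def)
    qed
    ultimately have "bij_betw s ({..<a} \<union> {a..}) (F \<union> ?R)"
      by (rule bij_betw_combine) (use F in auto)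
    moreover have "{..<a} \<union> {a..} = UNIV" by auto
    ultimately show "bij_betw s UNIV (F \<union> ?R)" by simp
    show "s \<longlonglongrightarrow> 0" using r0 by (simp add: LIMSEQ_offset[of s a] sr)
    have "summable (\<lambda>n. norm (s (Suc (n + a)) - s (n + a)))"
      using rsum sr[of "Suc n" for n] by (simp add: sr)
    then show "summable (\<lambda>n. norm (s (Suc n) - s n))"
      using summable_iff_shift[of "\<lambda>n. norm (s (Suc n) - s n)" a] by simp
    show "0 \<le> C" by (simp add: C_def)
  next
    fix f N assume f: "f \<in> BV \<sigma>"
    let ?t = "\<lambda>n. norm (f (s (Suc n)) - f (s n))"
    have mem: "s n \<in> \<sigma>" for n
      using rmem F(3) sF by (cases "n < a") (auto simp: s_def)
    have "?t n \<le> 2 * BV_norm \<sigma> f" for n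
      using norm_triangle_ineq4[of "f (s (Suc n))" "f (s n)"]
        BV_D(1)[OF f mem[of n]] BV_D(1)[OF f mem[of "Suc n"]] by simp
    then have 1: "(\<Sum>n<a. ?t n) \<le> (\<Sum>n<a. 2 * BV_norm \<sigma> f)" by (intro sum_mono)
    let ?S = "map r [0..<Suc N]"
    have S: "?S = map (\<lambda>n. complex_of_real (norm (r n)) * cis \<theta>) [0..<Suc N]"
      using rmem(2) by (simp add: mem_ray_iff del: upt_Suc)
    have vf: "vf ?S \<le> 2"
      unfolding S by (rule vf_monotone_collinear[of "\<lambda>n. norm (r n)", OF dec])
    have "(\<Sum>n<N. ?t (n + a)) = (\<Sum>n<N. norm (f (r (Suc n)) - f (r n)))"
      using sr[of "Suc n" for n] by (simp add: sr)
    also have "\<dots> = cvar f ?S" unfolding cvar_def by (rule sum.cong) (auto simp del: upt_Suc)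
    also have "\<dots> \<le> BV_norm \<sigma> f * real (vf ?S)"
    proof -
      have "?S \<noteq> [] \<and> set ?S \<subseteq> \<sigma>" using rmem by auto
      then show ?thesis using BV_D(2)[OF f] unfolding var_le_def by blast
    qed
    also have "\<dots> \<le> BV_norm \<sigma> f * 2" using vf by (intro mult_left_mono BV_norm_nonneg) simp
    finally have 2: "(\<Sum>n<N. ?t (n + a)) \<le> BV_norm \<sigma> f * 2" .
    have "(\<Sum>n<N. ?t n) \<le> (\<Sum>n<N + a. ?t n)" by (rule sum_mono2) auto
    also have "\<dots> = (\<Sum>n<a. ?t n) + (\<Sum>n<N. ?t (n + a))"
      by (induction N) simp_all
    also have "\<dots> \<le> (2 * real a + 2) * BV_norm \<sigma> f" using 1 2 by (simp add: algebra_simps)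
    also have "\<dots> \<le> C * BV_norm \<sigma> f"
      by (intro mult_right_mono BV_norm_nonneg) (simp add: C_def)
    finally show "(\<Sum>n<N. ?t n) \<le> C * BV_norm \<sigma> f" .
  next
    fix n
    show "var_le \<sigma> (indicator (s ` {..n})) C"
    proof (cases "n < a")
      case True
      then have sub: "s ` {..n} \<subseteq> F" using sF by auto
      then have "card (s ` {..n}) \<le> a" unfolding a_def by (intro card_mono F)
      moreover have "var_le \<sigma> (indicator (s ` {..n})) (4 * real (card (s ` {..n})))"
        by (rule var_le_finite) simp
      ultimately show ?thesis by (elim var_le_mono) (simp add: C_def)
    next
      case False
      let ?T = "{z \<in> ray \<theta>. norm (r (n - a)) \<le> norm z}"
      have tail: "z \<in> ?T \<longleftrightarrow> z \<in> r ` {..n - a}" if "z \<in> \<sigma>" for z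
      proof
        assume z: "z \<in> ?T"
        then have "z \<noteq> 0" using rmem(3)[of "n - a"] by auto
        then have "z \<in> range r" using that z bij_betw_imp_surj_on[OF r] by simp
        then obtain m where m: "z = r m" by blast
        then have "\<not> n - a < m" using z dec[of "n - a" m] by auto
        with m show "z \<in> r ` {..n - a}" by auto
      next
        assume "z \<in> r ` {..n - a}"
        then show "z \<in> ?T" using rmem dec by (fastforce simp: le_less)
      qed
      have "{..n} = {..<a} \<union> {a..n - a + a}" using False by auto
      also have "{a..n - a + a} = (\<lambda>m. m + a) ` {..n - a}"
        using image_add_atLeastAtMost'[of a 0 "n - a"] by (simp add: atLeast0AtMost)
      finally have "{..n} = {..<a} \<union> (\<lambda>m. m + a) ` {..n - a}" .
      then have "s ` {..n} = F \<union> r ` {..n - a}" using sF by (simp add: image_Un image_image sr)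
      with tail have "indicator (F \<union> ?T) z = (indicator (s ` {..n}) z :: complex)" if "z \<in> \<sigma>" for z
        using that by (simp add: indicator_def)
      then have "var_le \<sigma> (indicator (F \<union> ?T)) C = var_le \<sigma> (indicator (s ` {..n})) C"
        by (rule var_le_cong)
      moreover have "var_le \<sigma> (indicator (F \<union> ?T)) C"
        unfolding C_def a_def using rmem by (intro var_le_Un var_le_finite var_le_ray_tail F) auto
      ultimately show ?thesis by simp
    qed
  qed
qed

section \<open>Polynomials in two real variables\<close>

text \<open>Powers of both variables are truncated at the same bound \<open>N\<close>, as in \<open>polynomials_on\<close>.\<close>

definition bivariate_sum :: "nat \<Rightarrow> (nat \<Rightarrow> nat \<Rightarrow> complex) \<Rightarrow> complex \<Rightarrow> complex" where
  "bivariate_sum N c z = (\<Sum>n\<le>N. \<Sum>m\<le>N. c n m * complex_of_real (Re z) ^ n * complex_of_real (Im z) ^ m)"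

definition plane_polynomial :: "(complex \<Rightarrow> complex) \<Rightarrow> bool" where
  "plane_polynomial p \<longleftrightarrow> (\<exists>N c. p = bivariate_sum N c)"

lemma polynomials_on_iff:
  "f \<in> polynomials_on \<sigma> \<longleftrightarrow> (\<exists>p. plane_polynomial p \<and> f = (\<lambda>z. if z \<in> \<sigma> then p z else 0))"
  unfolding polynomials_on_def plane_polynomial_def bivariate_sum_def[symmetric] by blast

text \<open>With coefficients vanishing outside the square of side \<open>N\<close> the truncation may be enlarged at will,
  so that two polynomials can be added and a polynomial can be multiplied by a variable.\<close>

lemma plane_polynomial_padded:
  assumes "plane_polynomial p"
  obtains N c where "\<And>n m. N < n \<or> N < m \<Longrightarrow> c n m = 0"
    and "\<And>N'. N \<le> N' \<Longrightarrow> p = bivariate_sum N' c"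
proof -
  obtain N c where p: "p = bivariate_sum N c"
    using assms by (auto simp: plane_polynomial_def)
  define d where "d n m = (if n \<le> N \<and> m \<le> N then c n m else 0)" for n m
  show thesis
  proof (rule that[of N d])
    fix N' assume le: "N \<le> N'"
    show "p = bivariate_sum N' d"
    proof
      fix z
      have "p z = (\<Sum>n\<le>N. \<Sum>m\<le>N. d n m * complex_of_real (Re z) ^ n * complex_of_real (Im z) ^ m)"
        unfolding p bivariate_sum_def by (intro sum.cong) (auto simp: d_def)
      also have "\<dots> = (\<Sum>n\<le>N. \<Sum>m\<le>N'. d n m * complex_of_real (Re z) ^ n * complex_of_real (Im z) ^ m)"
        using le by (intro sum.cong[OF refl] sum.mono_neutral_left) (auto simp: d_def)
      also have "\<dots> = bivariate_sum N' d z"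
        unfolding bivariate_sum_def using le by (intro sum.mono_neutral_left) (auto simp: d_def)
      finally show "p z = bivariate_sum N' d z" .
    qed
  qed (auto simp: d_def)
qed

lemma plane_polynomial_const: "plane_polynomial (\<lambda>z. c)"
  unfolding plane_polynomial_def
  by (intro exI[of _ 0] exI[of _ "\<lambda>_ _. c"]) (simp add: bivariate_sum_def fun_eq_iff)

lemma plane_polynomial_add:
  assumes "plane_polynomial p" "plane_polynomial q"
  shows "plane_polynomial (\<lambda>z. p z + q z)"
proof -
  obtain N c where p: "\<And>N'. N \<le> N' \<Longrightarrow> p = bivariate_sum N' c"
    using plane_polynomial_padded[OF assms(1)] by blast
  obtain M d where q: "\<And>N'. M \<le> N' \<Longrightarrow> q = bivariate_sum N' d"
    using plane_polynomial_padded[OF assms(2)] by blast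
  have "(\<lambda>z. p z + q z) = bivariate_sum (max N M) (\<lambda>n m. c n m + d n m)"
    using p[of "max N M"] q[of "max N M"]
    by (simp add: bivariate_sum_def fun_eq_iff sum.distrib distrib_right)
  then show ?thesis by (auto simp: plane_polynomial_def)
qed

lemma plane_polynomial_scale:
  assumes "plane_polynomial p"
  shows "plane_polynomial (\<lambda>z. a * p z)"
proof -
  obtain N c where "p = bivariate_sum N c"
    using assms by (auto simp: plane_polynomial_def)
  then have "(\<lambda>z. a * p z) = bivariate_sum N (\<lambda>n m. a * c n m)"
    by (simp add: bivariate_sum_def fun_eq_iff sum_distrib_left mult.assoc)
  then show ?thesis by (auto simp: plane_polynomial_def)
qed

lemma plane_polynomial_Re_mult:
  assumes "plane_polynomial p"
  shows "plane_polynomial (\<lambda>z. complex_of_real (Re z) * p z)"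
proof -
  obtain N c where c: "\<And>n m. N < n \<or> N < m \<Longrightarrow> c n m = 0" and p: "p = bivariate_sum N c"
    using plane_polynomial_padded[OF assms] by blast
  have "complex_of_real (Re z) * p z =
      bivariate_sum (Suc N) (\<lambda>n m. case n of 0 \<Rightarrow> 0 | Suc n' \<Rightarrow> c n' m) z" for z
    unfolding p bivariate_sum_def
    by (subst sum.atMost_Suc_shift) (simp add: c sum_distrib_left mult_ac)
  then show ?thesis unfolding plane_polynomial_def by blast
qed

lemma plane_polynomial_Im_mult:
  assumes "plane_polynomial p"
  shows "plane_polynomial (\<lambda>z. complex_of_real (Im z) * p z)"
proof -
  obtain N c where c: "\<And>n m. N < n \<or> N < m \<Longrightarrow> c n m = 0" and p: "p = bivariate_sum N c"
    using plane_polynomial_padded[OF assms] by blast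
  have "complex_of_real (Im z) * p z =
      bivariate_sum (Suc N) (\<lambda>n m. case m of 0 \<Rightarrow> 0 | Suc m' \<Rightarrow> c n m') z" for z
  proof -
    have "(\<Sum>m\<le>Suc N. (case m of 0 \<Rightarrow> 0 | Suc m' \<Rightarrow> c n m') * complex_of_real (Re z) ^ n * complex_of_real (Im z) ^ m)
        = complex_of_real (Im z) * (\<Sum>m\<le>N. c n m * complex_of_real (Re z) ^ n * complex_of_real (Im z) ^ m)" for n
      by (subst sum.atMost_Suc_shift) (simp add: sum_distrib_left mult_ac)
    then show ?thesis
      unfolding p bivariate_sum_def by (simp only:) (simp add: c sum_distrib_left)
  qed
  then show ?thesis unfolding plane_polynomial_def by blast
qed

text \<open>For \<open>M > 0\<close> these are the powers of a quadratic polynomial whose strict maximum, at \<open>p\<close>, is 1.\<close>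

lemma plane_polynomial_peak_power:
  fixes p :: complex and M :: real
  shows "plane_polynomial (\<lambda>z. complex_of_real (1 - (norm (z - p))\<^sup>2 / M) ^ n)"
proof (induction n)
  case 0
  show ?case by (simp add: plane_polynomial_const)
next
  case (Suc n)
  let ?x = "\<lambda>z. complex_of_real (Re z)" and ?y = "\<lambda>z. complex_of_real (Im z)"
  let ?q = "\<lambda>z. complex_of_real (1 - (norm (z - p))\<^sup>2 / M) ^ n"
  have "plane_polynomial (\<lambda>z.
      complex_of_real (1 - (norm p)\<^sup>2 / M) * ?q z
      + complex_of_real (2 * Re p / M) * (?x z * ?q z)
      + complex_of_real (2 * Im p / M) * (?y z * ?q z)
      + complex_of_real (- 1 / M) * (?x z * (?x z * ?q z))
      + complex_of_real (- 1 / M) * (?y z * (?y z * ?q z)))"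
    by (intro plane_polynomial_add plane_polynomial_scale plane_polynomial_Re_mult
          plane_polynomial_Im_mult Suc.IH)
  also have "(\<lambda>z.
      complex_of_real (1 - (norm p)\<^sup>2 / M) * ?q z
      + complex_of_real (2 * Re p / M) * (?x z * ?q z)
      + complex_of_real (2 * Im p / M) * (?y z * ?q z)
      + complex_of_real (- 1 / M) * (?x z * (?x z * ?q z))
      + complex_of_real (- 1 / M) * (?y z * (?y z * ?q z))) =
      (\<lambda>z. complex_of_real (1 - (norm (z - p))\<^sup>2 / M) ^ Suc n)" (is "?l = ?r")
  proof
    fix z
    have *: "1 - (norm (z - p))\<^sup>2 / M = (1 - (norm p)\<^sup>2 / M) + (2 * Re p / M) * Re z
        + (2 * Im p / M) * Im z + (- 1 / M) * (Re z * Re z) + (- 1 / M) * (Im z * Im z)"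
      unfolding cmod_power2
      by (simp add: power2_eq_square algebra_simps add_divide_distrib diff_divide_distrib)
    have "?r z = complex_of_real (1 - (norm (z - p))\<^sup>2 / M) * ?q z" by simp
    also have "\<dots> = ?l z" by (subst (1) *) (simp add: algebra_simps)
    finally show "?l z = ?r z" by simp
  qed
  finally show ?case .
qed

lemma polynomials_on_add:
  assumes "f \<in> polynomials_on \<sigma>" "g \<in> polynomials_on \<sigma>"
  shows "(\<lambda>z. f z + g z) \<in> polynomials_on \<sigma>"
proof -
  obtain p q where "plane_polynomial p" "plane_polynomial q"
    and "f = (\<lambda>z. if z \<in> \<sigma> then p z else 0)" "g = (\<lambda>z. if z \<in> \<sigma> then q z else 0)"
    using assms by (auto simp: polynomials_on_iff)
  then show ?thesis
    unfolding polynomials_on_iff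
    by (intro exI[of _ "\<lambda>z. p z + q z"]) (auto simp: plane_polynomial_add)
qed

lemma polynomials_on_scale:
  assumes "f \<in> polynomials_on \<sigma>"
  shows "(\<lambda>z. c * f z) \<in> polynomials_on \<sigma>"
proof -
  obtain p where "plane_polynomial p" and "f = (\<lambda>z. if z \<in> \<sigma> then p z else 0)"
    using assms by (auto simp: polynomials_on_iff)
  then show ?thesis
    unfolding polynomials_on_iff
    by (intro exI[of _ "\<lambda>z. c * p z"]) (auto simp: plane_polynomial_scale)
qed

lemma AC_add:
  assumes "f \<in> AC \<sigma>" "g \<in> AC \<sigma>"
  shows "(\<lambda>z. f z + g z) \<in> AC \<sigma>"
  unfolding AC_iff
proof (intro conjI allI impI)
  have f: "f \<in> BV \<sigma>" and g: "g \<in> BV \<sigma>" using assms AC_subset_BV by auto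
  then show "(\<lambda>z. f z + g z) \<in> BV \<sigma>" by (rule BV_add)
  fix e :: real assume "0 < e"
  obtain p where p: "p \<in> polynomials_on \<sigma>" "p \<in> BV \<sigma>" "BV_norm \<sigma> (\<lambda>z. f z - p z) < e / 2"
    using assms(1) \<open>0 < e\<close> unfolding AC_iff by (metis IntE half_gt_zero)
  obtain q where q: "q \<in> polynomials_on \<sigma>" "q \<in> BV \<sigma>" "BV_norm \<sigma> (\<lambda>z. g z - q z) < e / 2"
    using assms(2) \<open>0 < e\<close> unfolding AC_iff by (metis IntE half_gt_zero)
  have "BV_norm \<sigma> (\<lambda>z. (f z - p z) + (g z - q z))
      \<le> BV_norm \<sigma> (\<lambda>z. f z - p z) + BV_norm \<sigma> (\<lambda>z. g z - q z)"
    using f g p q by (intro BV_add(2) BV_diff(1))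
  also have "\<dots> < e" using p q by simp
  finally have "BV_norm \<sigma> (\<lambda>z. (f z + g z) - (p z + q z)) < e" by (simp add: algebra_simps)
  then show "\<exists>p\<in>polynomials_on \<sigma> \<inter> BV \<sigma>. BV_norm \<sigma> (\<lambda>z. f z + g z - p z) < e"
    using p q by (intro bexI[of _ "\<lambda>z. p z + q z"]) (auto intro: polynomials_on_add BV_add)
qed

lemma AC_scale:
  assumes "f \<in> AC \<sigma>"
  shows "(\<lambda>z. c * f z) \<in> AC \<sigma>"
  unfolding AC_iff
proof (intro conjI allI impI)
  have f: "f \<in> BV \<sigma>" using assms AC_subset_BV by auto
  then show "(\<lambda>z. c * f z) \<in> BV \<sigma>" by (rule BV_scale)
  fix e :: real assume "0 < e"
  have c: "0 < norm c + 1" by (rule add_nonneg_pos) auto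
  with \<open>0 < e\<close> have "0 < e / (norm c + 1)" by (rule divide_pos_pos)
  then obtain p where p: "p \<in> polynomials_on \<sigma>" "p \<in> BV \<sigma>"
    "BV_norm \<sigma> (\<lambda>z. f z - p z) < e / (norm c + 1)"
    using assms unfolding AC_iff by (metis IntE)
  have "BV_norm \<sigma> (\<lambda>z. c * (f z - p z)) \<le> norm c * BV_norm \<sigma> (\<lambda>z. f z - p z)"
    using f p by (intro BV_scale(2) BV_diff(1))
  also have "\<dots> \<le> BV_norm \<sigma> (\<lambda>z. f z - p z) * (norm c + 1)"
    using BV_norm_nonneg[of \<sigma> "\<lambda>z. f z - p z"] by (simp add: algebra_simps)
  also have "\<dots> < e" using p(3) c by (simp add: pos_less_divide_eq)
  finally have "BV_norm \<sigma> (\<lambda>z. c * f z - c * p z) < e" by (simp add: algebra_simps)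
  then show "\<exists>p\<in>polynomials_on \<sigma> \<inter> BV \<sigma>. BV_norm \<sigma> (\<lambda>z. c * f z - p z) < e"
    using p by (intro bexI[of _ "\<lambda>z. c * p z"]) (auto intro: polynomials_on_scale BV_scale)
qed

section \<open>Jumps along sequences of points\<close>

text \<open>\<open>s j\<close> is the sequence of points attached to the \<open>j\<close>-th ray.\<close>

definition step :: "(nat \<Rightarrow> nat \<Rightarrow> complex) \<Rightarrow> (complex \<Rightarrow> complex) \<Rightarrow> nat \<Rightarrow> nat \<Rightarrow> real" where
  "step s f j n = norm (f (s j (Suc n)) - f (s j n))"

definition ray_regular :: "nat \<Rightarrow> (nat \<Rightarrow> nat \<Rightarrow> complex) \<Rightarrow> (complex \<Rightarrow> complex) \<Rightarrow> bool" where
  "ray_regular k s f \<longleftrightarrow> (\<forall>j<k. summable (step s f j) \<and> (\<lambda>n. f (s j n)) \<longlonglongrightarrow> f 0)"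

text \<open>For \<open>f\<close> converging along every sequence to its value at \<open>0\<close>, this controls the supremum of \<open>f\<close> too.\<close>

definition ray_norm :: "nat \<Rightarrow> (nat \<Rightarrow> nat \<Rightarrow> complex) \<Rightarrow> (complex \<Rightarrow> complex) \<Rightarrow> real" where
  "ray_norm k s f = norm (f 0) + (\<Sum>j<k. \<Sum>n. step s f j n)"

lemma step_nonneg: "0 \<le> step s f j n"
  by (simp add: step_def)

lemma ray_regular_const: "ray_regular k s (\<lambda>z. c)"
proof -
  have "step s (\<lambda>z. c) = (\<lambda>j n. 0)" by (simp add: step_def fun_eq_iff)
  then show ?thesis by (simp add: ray_regular_def)
qed

lemma ray_regular_add:
  assumes "ray_regular k s f" "ray_regular k s g"
  shows "ray_regular k s (\<lambda>z. f z + g z)"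
  unfolding ray_regular_def
proof (intro allI impI conjI)
  fix j assume j: "j < k"
  have le: "step s (\<lambda>z. f z + g z) j n \<le> step s f j n + step s g j n" for n
    unfolding step_def by (metis add_diff_add norm_triangle_ineq)
  show "summable (step s (\<lambda>z. f z + g z) j)"
  proof (rule summable_comparison_test'[of "\<lambda>n. step s f j n + step s g j n" 0])
    show "summable (\<lambda>n. step s f j n + step s g j n)"
      using assms j by (intro summable_add) (auto simp: ray_regular_def)
  qed (use le in \<open>simp add: step_nonneg\<close>)
  show "(\<lambda>n. f (s j n) + g (s j n)) \<longlonglongrightarrow> f 0 + g 0"
    using assms j by (intro tendsto_add) (auto simp: ray_regular_def)
qed

lemma ray_regular_mult:
  assumes f: "ray_regular k s f" and g: "ray_regular k s g"
  shows "ray_regular k s (\<lambda>z. f z * g z)"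
  unfolding ray_regular_def
proof (intro allI impI conjI)
  fix j assume j: "j < k"
  have lim: "(\<lambda>n. f (s j n)) \<longlonglongrightarrow> f 0" "(\<lambda>n. g (s j n)) \<longlonglongrightarrow> g 0"
    using assms j by (auto simp: ray_regular_def)
  then have "Bseq (\<lambda>n. f (s j n))" "Bseq (\<lambda>n. g (s j n))"
    by (auto intro!: convergent_imp_Bseq simp: convergent_def)
  then obtain A B where A: "\<And>n. norm (f (s j n)) \<le> A" and B: "\<And>n. norm (g (s j n)) \<le> B"
    unfolding Bseq_def by metis
  have le: "step s (\<lambda>z. f z * g z) j n \<le> A * step s g j n + B * step s f j n" for n
  proof -
    let ?x = "s j n" and ?y = "s j (Suc n)"
    have "f ?y * g ?y - f ?x * g ?x = f ?y * (g ?y - g ?x) + g ?x * (f ?y - f ?x)"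
      by (simp add: algebra_simps)
    then have "step s (\<lambda>z. f z * g z) j n \<le> norm (f ?y) * step s g j n + norm (g ?x) * step s f j n"
      unfolding step_def by (metis norm_mult norm_triangle_ineq)
    also have "\<dots> \<le> A * step s g j n + B * step s f j n"
      by (intro add_mono mult_right_mono A B step_nonneg)
    finally show ?thesis .
  qed
  show "summable (step s (\<lambda>z. f z * g z) j)"
  proof (rule summable_comparison_test'[of "\<lambda>n. A * step s g j n + B * step s f j n" 0])
    show "summable (\<lambda>n. A * step s g j n + B * step s f j n)"
      using assms j by (intro summable_add summable_mult) (auto simp: ray_regular_def)
  qed (use le in \<open>simp add: step_nonneg\<close>)
  show "(\<lambda>n. f (s j n) * g (s j n)) \<longlonglongrightarrow> f 0 * g 0"
    using lim by (rule tendsto_mult)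
qed

lemma ray_regular_sum:
  "finite I \<Longrightarrow> (\<And>i. i \<in> I \<Longrightarrow> ray_regular k s (f i)) \<Longrightarrow> ray_regular k s (\<lambda>z. \<Sum>i\<in>I. f i z)"
  by (induction rule: finite_induct) (auto intro: ray_regular_const ray_regular_add)

lemma ray_regular_power: "ray_regular k s f \<Longrightarrow> ray_regular k s (\<lambda>z. f z ^ n)"
  by (induction n) (auto intro: ray_regular_const ray_regular_mult)

section \<open>Equivalence of the BV norm and the sum of the jumps\<close>

text \<open>What is kept of the geometry of a ray set: a partition of the nonzero points into \<open>k\<close> sequences
  that converge to \<open>0\<close> and have finite length, and a constant \<open>C\<close> such that jumps along a sequence are
  bounded by the \<open>BV\<close> norm and initial segments of a sequence have indicators of variation at most
  \<open>C\<close>. Points off the rays are absorbed into the first sequence.\<close>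

locale ray_enumeration =
  fixes k :: nat and \<sigma> :: "complex set" and s :: "nat \<Rightarrow> nat \<Rightarrow> complex" and C :: real
  assumes C_set: "C_set \<sigma>"
    and mem: "j < k \<Longrightarrow> s j n \<in> \<sigma>"
    and nonzero: "j < k \<Longrightarrow> s j n \<noteq> 0"
    and inj: "i < k \<Longrightarrow> j < k \<Longrightarrow> s i m = s j n \<Longrightarrow> i = j \<and> m = n"
    and surj: "z \<in> \<sigma> \<Longrightarrow> z \<noteq> 0 \<Longrightarrow> \<exists>j<k. \<exists>n. z = s j n"
    and lim: "j < k \<Longrightarrow> s j \<longlonglongrightarrow> 0"
    and summable: "j < k \<Longrightarrow> summable (\<lambda>n. norm (s j (Suc n) - s j n))"
    and C_nonneg: "0 \<le> C"
    and step_le: "j < k \<Longrightarrow> f \<in> BV \<sigma> \<Longrightarrow> (\<Sum>n<N. step s f j n) \<le> C * BV_norm \<sigma> f"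
    and var_initial: "j < k \<Longrightarrow> var_le \<sigma> (indicator (s j ` {..n})) C"
begin

lemma zero_mem: "0 \<in> \<sigma>"
  using C_set by (rule C_set_zero_mem)

lemma cases_points:
  assumes "z \<in> \<sigma>"
  obtains "z = 0" | j n where "j < k" "z = s j n"
  using surj[OF assms] by blast

text \<open>The lower half of the equivalence between the \<open>BV\<close> norm and \<open>ray_norm\<close>.\<close>

lemma ray_norm_le:
  assumes f: "f \<in> BV \<sigma>"
  shows "j < k \<Longrightarrow> summable (step s f j)" and "ray_norm k s f \<le> (1 + real k * C) * BV_norm \<sigma> f"
proof -
  show sum: "summable (step s f j)" if "j < k" for j
    using step_le[OF that f]
    by (intro summableI_nonneg_bounded[of _ "C * BV_norm \<sigma> f"]) (auto simp: step_nonneg)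
  then have "(\<Sum>j<k. \<Sum>n. step s f j n) \<le> (\<Sum>j<k. C * BV_norm \<sigma> f)"
    using step_le[OF _ f] by (intro sum_mono suminf_le_const) auto
  moreover have "norm (f 0) \<le> BV_norm \<sigma> f" using BV_D(1)[OF f zero_mem] .
  ultimately show "ray_norm k s f \<le> (1 + real k * C) * BV_norm \<sigma> f"
    by (simp add: ray_norm_def algebra_simps)
qed

text \<open>The upper half. Telescoping along each sequence writes \<open>f - f 0\<close> as an infinite combination of the
  indicators of initial segments, whose coefficients are the increments of \<open>f\<close> along the sequence. All
  these indicators have variation at most \<open>C\<close>, so the variation of \<open>f\<close> is at most \<open>C\<close> times the sum of
  the moduli of the increments.\<close>

lemma BV_norm_le:
  assumes f: "f \<in> functions_on \<sigma>" and reg: "ray_regular k s f"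
  shows "f \<in> BV \<sigma>" and "BV_norm \<sigma> f \<le> (1 + C) * ray_norm k s f"
proof -
  define d where "d j n = f (s j n) - f (s j (Suc n))" for j n
  define I where "I j n = (indicator (s j ` {..n}) :: complex \<Rightarrow> complex)" for j n
  define g where "g j z = (\<Sum>n. d j n * I j n z)" for j z
  define V where "V j = (\<Sum>n. step s f j n)" for j
  have step_d: "step s f j n = norm (d j n)" for j n
    by (simp add: step_def d_def norm_minus_commute)
  have sum: "summable (step s f j)" if "j < k" for j
    using reg that by (auto simp: ray_regular_def)
  have V: "0 \<le> V j" if "j < k" for j
    unfolding V_def using sum[OF that] step_nonneg by (rule suminf_nonneg)
  have I_norm: "norm (I j n z) \<le> 1" "norm (I j n y - I j n z) \<le> 1" for j n y z
    by (auto simp: I_def indicator_def)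
  have summ: "summable (\<lambda>n. d j n * I j n z)" if "j < k" for j z
    by (rule summable_comparison_test'[OF sum[OF that], of 0])
       (auto simp: norm_mult step_d intro: mult_left_le I_norm)
  have I_self: "I j n (s j m) = (if m \<le> n then 1 else 0)" if "j < k" for j m n
    using inj[OF that that] by (auto simp: I_def indicator_def)
  have I_other: "I j n z = 0" if "j < k" "z = 0 \<or> (\<exists>i<k. i \<noteq> j \<and> (\<exists>m. z = s i m))" for j n z
    using that inj nonzero[OF that(1)] by (auto simp: I_def indicator_def)
  have g_self: "g j (s j m) = f (s j m) - f 0" if "j < k" for j m
  proof -
    have lim': "(\<lambda>n. f (s j n)) \<longlonglongrightarrow> f 0" using reg that by (auto simp: ray_regular_def)
    have "(\<lambda>n. f (s j (n + m))) \<longlonglongrightarrow> f 0" using lim' by (rule LIMSEQ_ignore_initial_segment)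
    from telescope_sums'[OF this]
    have "(\<lambda>n. d j (n + m) * I j (n + m) (s j m)) sums (f (s j m) - f 0)"
      using that by (simp add: d_def I_self)
    then have "(\<lambda>n. d j n * I j n (s j m)) sums (f (s j m) - f 0)"
      using that by (subst (asm) sums_zero_iff_shift) (auto simp: I_self)
    then show ?thesis by (simp add: g_def sums_iff)
  qed
  \<comment> \<open>for \<open>z = s i m\<close> only the terms of the sequence \<open>i\<close> with index at least \<open>m\<close> survive, and they telescope\<close>
  have expand: "f z = f 0 + (\<Sum>j<k. g j z)" if "z \<in> \<sigma>" for z
    using that
  proof (cases rule: cases_points)
    case 1
    then show ?thesis by (simp add: g_def I_other)
  next
    case (2 i m)
    have "g j z = (if j = i then f z - f 0 else 0)" if j: "j < k" for j
    proof (cases "j = i")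
      case True
      with 2 g_self[OF j] show ?thesis by simp
    next
      case False
      then have "I j n z = 0" for n using I_other[OF j] 2 by blast
      with False show ?thesis by (simp add: g_def)
    qed
    then have "(\<Sum>j<k. g j z) = (\<Sum>j<k. if j = i then f z - f 0 else 0)" by simp
    with 2 show ?thesis by simp
  qed
  have bound: "norm (\<Sum>n. d j n * c n) \<le> V j" if "j < k" "\<And>n. norm (c n) \<le> 1" for j c
    unfolding V_def
  proof (rule order_trans[OF norm_suminf_le])
    show "norm (d j n * c n) \<le> step s f j n" for n
      using that(2)[of n] by (auto simp: norm_mult step_d intro: mult_left_le)
  qed (use sum that in auto)
  have "norm (f z) \<le> ray_norm k s f" if "z \<in> \<sigma>" for z
  proof -
    have "norm (f z) \<le> norm (f 0) + norm (\<Sum>j<k. g j z)"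
      by (subst expand[OF that]) (rule norm_triangle_ineq)
    also have "\<dots> \<le> norm (f 0) + (\<Sum>j<k. norm (g j z))"
      by (intro add_left_mono norm_sum)
    also have "\<dots> \<le> norm (f 0) + (\<Sum>j<k. V j)"
      unfolding g_def by (intro add_left_mono sum_mono bound I_norm) auto
    finally show ?thesis by (simp add: ray_norm_def V_def)
  qed
  moreover have "var_le \<sigma> f (C * ray_norm k s f)"
    unfolding var_le_def
  proof (intro allI impI)
    fix S assume S: "S \<noteq> [] \<and> set S \<subseteq> \<sigma>"
    let ?J = "\<lambda>j n i. norm (I j n (S ! Suc i) - I j n (S ! i))"
    have sJ: "summable (\<lambda>n. step s f j n * ?J j n i)" if "j < k" for j i
      by (rule summable_comparison_test'[OF sum[OF that], of 0])
         (auto simp: step_nonneg intro: mult_left_le I_norm)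
    have "norm (f (S ! Suc i) - f (S ! i)) \<le> (\<Sum>j<k. \<Sum>n. step s f j n * ?J j n i)"
      if "i < length S - 1" for i
    proof -
      have "S ! i \<in> set S" "S ! Suc i \<in> set S" using that by auto
      with S have mem: "S ! i \<in> \<sigma>" "S ! Suc i \<in> \<sigma>" by blast+
      have "norm (f (S ! Suc i) - f (S ! i)) = norm (\<Sum>j<k. g j (S ! Suc i) - g j (S ! i))"
        using expand[OF mem(1)] expand[OF mem(2)] by (simp add: sum_subtractf)
      also have "\<dots> \<le> (\<Sum>j<k. norm (g j (S ! Suc i) - g j (S ! i)))" by (rule norm_sum)
      also have "\<dots> \<le> (\<Sum>j<k. \<Sum>n. step s f j n * ?J j n i)"
      proof (rule sum_mono)
        fix j assume "j \<in> {..<k}"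
        then have j: "j < k" by simp
        have "norm (g j (S ! Suc i) - g j (S ! i))
            = norm (\<Sum>n. d j n * I j n (S ! Suc i) - d j n * I j n (S ! i))"
          unfolding g_def by (simp only: suminf_diff[OF summ[OF j] summ[OF j]])
        also have "\<dots> \<le> (\<Sum>n. step s f j n * ?J j n i)"
        proof (rule norm_suminf_le)
          show "norm (d j n * I j n (S ! Suc i) - d j n * I j n (S ! i)) \<le> step s f j n * ?J j n i" for n
            by (simp add: step_d flip: norm_mult right_diff_distrib)
        qed (rule sJ[OF j])
        finally show "norm (g j (S ! Suc i) - g j (S ! i)) \<le> \<dots>" .
      qed
      finally show ?thesis .
    qed
    then have "cvar f S \<le> (\<Sum>i<length S - 1. \<Sum>j<k. \<Sum>n. step s f j n * ?J j n i)"
      unfolding cvar_def by (intro sum_mono) auto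
    also have "\<dots> = (\<Sum>j<k. \<Sum>i<length S - 1. \<Sum>n. step s f j n * ?J j n i)" by (rule sum.swap)
    also have "\<dots> = (\<Sum>j<k. \<Sum>n. \<Sum>i<length S - 1. step s f j n * ?J j n i)"
      by (intro sum.cong refl suminf_sum[symmetric] sJ) auto
    also have "\<dots> = (\<Sum>j<k. \<Sum>n. step s f j n * cvar (I j n) S)"
      by (simp add: cvar_def sum_distrib_left)
    also have "\<dots> \<le> (\<Sum>j<k. \<Sum>n. step s f j n * (C * real (vf S)))"
    proof (rule sum_mono)
      fix j assume "j \<in> {..<k}"
      then have j: "j < k" by simp
      have le: "step s f j n * cvar (I j n) S \<le> step s f j n * (C * real (vf S))" for n
        using var_initial[OF j, of n] S unfolding var_le_def I_def
        by (intro mult_left_mono step_nonneg) auto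
      have summ2: "summable (\<lambda>n. step s f j n * (C * real (vf S)))"
        using sum[OF j] by (rule summable_mult2)
      have "summable (\<lambda>n. step s f j n * cvar (I j n) S)"
        by (rule summable_comparison_test'[OF summ2, of 0])
           (use le in \<open>auto simp: step_nonneg cvar_nonneg\<close>)
      then show "(\<Sum>n. step s f j n * cvar (I j n) S) \<le> (\<Sum>n. step s f j n * (C * real (vf S)))"
        using summ2 le by (intro suminf_le) auto
    qed
    also have "\<dots> = (\<Sum>j<k. V j * (C * real (vf S)))"
      unfolding V_def by (intro sum.cong refl suminf_mult2[symmetric] sum) auto
    also have "\<dots> = (\<Sum>j<k. V j) * (C * real (vf S))" by (rule sum_distrib_right[symmetric])
    also have "\<dots> \<le> ray_norm k s f * (C * real (vf S))"
      using C_nonneg by (intro mult_right_mono) (auto simp: ray_norm_def V_def)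
    finally show "cvar f S \<le> C * ray_norm k s f * real (vf S)" by (simp add: mult_ac)
  qed
  moreover have "0 \<le> ray_norm k s f"
    using V by (auto simp: ray_norm_def V_def[symmetric] intro!: add_nonneg_nonneg sum_nonneg)
  ultimately show "f \<in> BV \<sigma>" "BV_norm \<sigma> f \<le> (1 + C) * ray_norm k s f"
    using BV_I[OF f, of "ray_norm k s f" "C * ray_norm k s f"] C_nonneg
    by (auto simp: algebra_simps)
qed

end

context ray_enumeration
begin

section \<open>Absolutely continuous functions\<close>

lemma step_cong:
  assumes "\<And>z. z \<in> \<sigma> \<Longrightarrow> f z = g z" and "j < k"
  shows "step s f j = step s g j"
  using assms mem by (simp add: step_def fun_eq_iff)

lemma ray_regular_cong:
  assumes "\<And>z. z \<in> \<sigma> \<Longrightarrow> f z = g z"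
  shows "ray_regular k s f \<longleftrightarrow> ray_regular k s g"
  using assms mem zero_mem by (auto simp: ray_regular_def step_cong[of f g])

text \<open>The sequences have finite length, so a Lipschitz function has summable jumps along them, and a
  small Lipschitz constant makes these sums small.\<close>

lemma lipschitz_ray_regular:
  assumes lip: "\<And>x y. x \<in> \<sigma> \<Longrightarrow> y \<in> \<sigma> \<Longrightarrow> norm (g x - g y) \<le> L * norm (x - y)"
  shows "ray_regular k s g"
    and "ray_norm k s g \<le> norm (g 0) + L * (\<Sum>j<k. \<Sum>n. norm (s j (Suc n) - s j n))"
proof -
  have le: "step s g j n \<le> L * norm (s j (Suc n) - s j n)" if "j < k" for j n
    unfolding step_def using mem that by (intro lip) auto
  have sm: "summable (\<lambda>n. L * norm (s j (Suc n) - s j n))" if "j < k" for j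
    using summable[OF that] by (rule summable_mult)
  have sg: "summable (step s g j)" if "j < k" for j
    by (rule summable_comparison_test'[OF sm[OF that], of 0]) (use le that in \<open>simp add: step_nonneg\<close>)
  have "(\<lambda>n. g (s j n)) \<longlonglongrightarrow> g 0" if "j < k" for j
  proof -
    have "(\<lambda>n. L * norm (s j n)) \<longlonglongrightarrow> L * 0"
      by (intro tendsto_mult tendsto_const tendsto_norm_zero lim that)
    then have "(\<lambda>n. g (s j n) - g 0) \<longlonglongrightarrow> 0"
      using lip[OF mem[OF that] zero_mem]
      by (intro Lim_null_comparison[of "\<lambda>n. g (s j n) - g 0" "\<lambda>n. L * norm (s j n)"]) auto
    then show ?thesis by (simp add: LIM_zero_iff)
  qed
  with sg show "ray_regular k s g" by (simp add: ray_regular_def)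
  have "(\<Sum>j<k. \<Sum>n. step s g j n) \<le> (\<Sum>j<k. \<Sum>n. L * norm (s j (Suc n) - s j n))"
    using le sg sm by (intro sum_mono suminf_le) auto
  also have "\<dots> = L * (\<Sum>j<k. \<Sum>n. norm (s j (Suc n) - s j n))"
    by (simp add: sum_distrib_left suminf_mult summable)
  finally show "ray_norm k s g \<le> norm (g 0) + L * (\<Sum>j<k. \<Sum>n. norm (s j (Suc n) - s j n))"
    by (simp add: ray_norm_def)
qed

lemma polynomial_ray_regular:
  assumes "plane_polynomial p"
  shows "ray_regular k s p"
proof -
  have Re: "ray_regular k s (\<lambda>z. complex_of_real (Re z))"
    by (rule lipschitz_ray_regular(1)[of _ 1])
       (metis abs_Re_le_cmod minus_complex.sel(1) mult_1 norm_of_real of_real_diff)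
  have Im: "ray_regular k s (\<lambda>z. complex_of_real (Im z))"
    by (rule lipschitz_ray_regular(1)[of _ 1])
       (metis abs_Im_le_cmod minus_complex.sel(2) mult_1 norm_of_real of_real_diff)
  from assms obtain N c where "p = bivariate_sum N c" by (auto simp: plane_polynomial_def)
  then have "p = (\<lambda>z. \<Sum>n\<le>N. \<Sum>m\<le>N. c n m * complex_of_real (Re z) ^ n * complex_of_real (Im z) ^ m)"
    by (simp add: bivariate_sum_def fun_eq_iff)
  then show ?thesis
    by (auto intro!: ray_regular_sum ray_regular_mult ray_regular_const ray_regular_power Re Im)
qed

lemma polynomial_AC:
  assumes "plane_polynomial p"
  shows "(\<lambda>z. if z \<in> \<sigma> then p z else 0) \<in> AC \<sigma>" (is "?p \<in> _")
proof -
  have "?p \<in> functions_on \<sigma>" by (simp add: functions_on_def)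
  moreover have "ray_regular k s ?p"
    using polynomial_ray_regular[OF assms] by (subst ray_regular_cong[of _ p]) auto
  ultimately have "?p \<in> BV \<sigma>" by (rule BV_norm_le)
  moreover have "?p \<in> polynomials_on \<sigma>" unfolding polynomials_on_iff using assms by blast
  ultimately show ?thesis using polynomials_subset_AC by blast
qed

text \<open>The \<open>BV\<close> norm dominates the supremum norm, so continuity at \<open>0\<close> passes from polynomials to limits.\<close>

lemma AC_ray_regular:
  assumes f: "f \<in> AC \<sigma>"
  shows "ray_regular k s f"
  unfolding ray_regular_def
proof (intro allI impI conjI)
  fix j assume j: "j < k"
  have fBV: "f \<in> BV \<sigma>" using f AC_subset_BV by auto
  then show "summable (step s f j)" using j by (rule ray_norm_le)
  show "(\<lambda>n. f (s j n)) \<longlonglongrightarrow> f 0"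
  proof (rule LIMSEQ_I)
    fix e :: real assume "0 < e"
    then obtain q where q: "q \<in> polynomials_on \<sigma>" "q \<in> BV \<sigma>" "BV_norm \<sigma> (\<lambda>z. f z - q z) < e / 3"
      using f unfolding AC_iff by (metis IntE divide_pos_pos zero_less_numeral)
    then obtain p where p: "plane_polynomial p" "q = (\<lambda>z. if z \<in> \<sigma> then p z else 0)"
      by (auto simp: polynomials_on_iff)
    have "(\<lambda>n. p (s j n)) \<longlonglongrightarrow> p 0"
      using polynomial_ray_regular[OF p(1)] j by (simp add: ray_regular_def)
    from LIMSEQ_D[OF this, of "e / 3"] \<open>0 < e\<close>
    obtain n0 where n0: "\<And>n. n0 \<le> n \<Longrightarrow> norm (p (s j n) - p 0) < e / 3" by auto
    have near: "norm (f z - p z) < e / 3" if "z \<in> \<sigma>" for z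
      using BV_D(1)[OF BV_diff(1)[OF fBV q(2)] that] q(3) p(2) that by simp
    have "norm (f (s j n) - f 0) < e" if "n0 \<le> n" for n
    proof -
      have "norm (f (s j n) - f 0)
          = norm ((f (s j n) - p (s j n)) + (p (s j n) - p 0) - (f 0 - p 0))" by simp
      also have "\<dots> \<le> norm ((f (s j n) - p (s j n)) + (p (s j n) - p 0)) + norm (f 0 - p 0)"
        by (rule norm_triangle_ineq4)
      also have "\<dots> \<le> norm (f (s j n) - p (s j n)) + norm (p (s j n) - p 0) + norm (f 0 - p 0)"
        by (intro add_right_mono norm_triangle_ineq)
      finally have "norm (f (s j n) - f 0)
          \<le> norm (f (s j n) - p (s j n)) + norm (p (s j n) - p 0) + norm (f 0 - p 0)" .
      with near[OF mem[OF j, of n]] near[OF zero_mem] n0[OF that] show ?thesis by simp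
    qed
    then show "\<exists>n0. \<forall>n\<ge>n0. norm (f (s j n) - f 0) < e" by blast
  qed
qed

text \<open>Let \<open>u\<close> be a quadratic polynomial with \<open>u p = 1\<close> and \<open>0 \<le> u \<le> q < 1\<close> on the other points of \<open>\<sigma>\<close>; it
  exists because \<open>p\<close> is isolated. Its powers converge to the indicator of \<open>p\<close>, not only uniformly:
  away from \<open>p\<close> the Lipschitz constant of \<open>u ^ n\<close> is of order \<open>n * q ^ n\<close>, so the difference has a
  Lipschitz constant tending to \<open>0\<close> and tends to \<open>0\<close> in the \<open>BV\<close> norm.\<close>

lemma indicator_AC:
  assumes p: "p \<in> \<sigma>" "p \<noteq> 0"
  shows "indicator {p} \<in> AC \<sigma>"
proof -
  have "bounded \<sigma>" using C_set by (auto simp: C_set_def compact_imp_bounded)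
  then obtain B where B: "\<And>z. z \<in> \<sigma> \<Longrightarrow> norm z \<le> B" by (auto simp: bounded_iff)
  define R where "R = \<bar>B\<bar> + norm p"
  have R: "0 < R" "\<And>z. z \<in> \<sigma> \<Longrightarrow> norm (z - p) \<le> R"
  proof -
    show "norm (z - p) \<le> R" if "z \<in> \<sigma>" for z
      using norm_triangle_ineq4[of z p] B[OF that] by (simp add: R_def)
  qed (use p in \<open>simp add: R_def add_nonneg_pos\<close>)
  have "\<not> p islimpt \<sigma>" using C_set p by (auto simp: C_set_def)
  then obtain d where "0 < d" and "\<forall>z\<in>\<sigma>. z \<noteq> p \<longrightarrow> \<not> dist z p < d"
    by (auto simp: islimpt_approachable)
  then have d: "0 < d" "\<And>z. z \<in> \<sigma> \<Longrightarrow> z \<noteq> p \<Longrightarrow> d \<le> norm (z - p)"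
    by (auto simp: dist_norm)
  \<comment> \<open>large enough for \<open>0 \<le> u\<close> on \<open>\<sigma>\<close>, and for \<open>q\<close> to be positive\<close>
  define M where "M = R\<^sup>2 + d\<^sup>2"
  have M: "0 < M" using R by (simp add: M_def add_pos_nonneg)
  define q where "q = 1 - d\<^sup>2 / M"
  have q: "0 < q" "q < 1" using M R d by (auto simp: q_def M_def)
  define u where "u z = 1 - (norm (z - p))\<^sup>2 / M" for z
  have u: "0 \<le> u z" "u z \<le> q" if "z \<in> \<sigma>" "z \<noteq> p" for z
  proof -
    have "(norm (z - p))\<^sup>2 \<le> R\<^sup>2" "d\<^sup>2 \<le> (norm (z - p))\<^sup>2"
      using R(2) d that by (auto intro!: power_mono)
    moreover have "R\<^sup>2 \<le> M" by (simp add: M_def)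
    ultimately show "0 \<le> u z" "u z \<le> q" using M by (auto simp: u_def q_def divide_right_mono)
  qed
  define L where "L = 2 * R / M"
  have "0 \<le> L" using R M by (simp add: L_def)
  have u_lip: "\<bar>u x - u y\<bar> \<le> L * norm (x - y)" if "x \<in> \<sigma>" "y \<in> \<sigma>" for x y
  proof -
    have "u x - u y = (norm (y - p) + norm (x - p)) * (norm (y - p) - norm (x - p)) / M"
      by (simp add: u_def power2_eq_square algebra_simps add_divide_distrib diff_divide_distrib)
    then have "\<bar>u x - u y\<bar> = (norm (y - p) + norm (x - p)) * \<bar>norm (y - p) - norm (x - p)\<bar> / M"
      using M by (simp add: abs_mult)
    also have "\<dots> \<le> (2 * R) * norm (x - y) / M"
    proof (intro divide_right_mono mult_mono)
      show "norm (y - p) + norm (x - p) \<le> 2 * R" using R(2)[OF that(1)] R(2)[OF that(2)] by simp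
      show "\<bar>norm (y - p) - norm (x - p)\<bar> \<le> norm (x - y)"
        using norm_triangle_ineq3[of "y - p" "x - p"] by (simp add: norm_minus_commute)
    qed (use R M in auto)
    finally show ?thesis by (simp add: L_def)
  qed
  define P where "P n z = (if z \<in> \<sigma> then complex_of_real (u z) ^ n else 0)" for n z
  define g where "g n z = indicator {p} z - P n z" for n z
  \<comment> \<open>Lipschitz constants of \<open>g n\<close>: the first term bounds pairs of points other than \<open>p\<close>, the second pairs containing \<open>p\<close>\<close>
  define K where "K n = L / q * (real n * q ^ n) + q ^ n / d" for n
  have P: "P n \<in> AC \<sigma>" for n
    unfolding P_def u_def using plane_polynomial_peak_power by (rule polynomial_AC)
  have g_p: "g n p = 0" for n using p by (simp add: g_def P_def u_def)
  have g_other: "g n z = - (complex_of_real (u z) ^ n)" if "z \<in> \<sigma>" "z \<noteq> p" for n z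
    using that by (simp add: g_def P_def)
  have g_small: "norm (g n z) \<le> q ^ n" if "z \<in> \<sigma>" for n z
    using u[of z] that q by (cases "z = p") (auto simp: g_p g_other norm_power power_mono)
  have K0: "0 \<le> K n" for n using \<open>0 \<le> L\<close> q d by (simp add: K_def)
  have g_lip: "norm (g n x - g n y) \<le> K n * norm (x - y)" if "x \<in> \<sigma>" "y \<in> \<sigma>" for n x y
  proof -
    have at_p: "norm (g n z) \<le> K n * norm (z - p)" if "z \<in> \<sigma>" for z
    proof (cases "z = p")
      case False
      have "norm (g n z) \<le> q ^ n / d * d" using g_small[OF that] d by simp
      also have "\<dots> \<le> q ^ n / d * norm (z - p)"
        using d(2)[OF that False] q d(1) by (intro mult_left_mono) auto
      also have "\<dots> \<le> K n * norm (z - p)"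
        using \<open>0 \<le> L\<close> q by (intro mult_right_mono) (auto simp: K_def)
      finally show ?thesis .
    qed (simp add: g_p)
    consider "x = p" | "y = p" | "x \<noteq> p" "y \<noteq> p" by blast
    then show ?thesis
    proof cases
      case 1
      then show ?thesis using at_p[OF that(2)] by (simp add: g_p norm_minus_commute)
    next
      case 2
      then show ?thesis using at_p[OF that(1)] by (simp add: g_p)
    next
      case 3
      \<comment> \<open>scaled to modulus at most 1, so that the factor \<open>q ^ n\<close> can be split off before powers are compared\<close>
      define v where "v z = complex_of_real (u z / q)" for z
      have v: "norm (v z) \<le> 1" if "z \<in> \<sigma>" "z \<noteq> p" for z
        using u[OF that] q by (simp add: v_def norm_divide)
      have g_v: "g n z = - (complex_of_real (q ^ n) * v z ^ n)" if "z \<in> \<sigma>" "z \<noteq> p" for z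
        using g_other[OF that] q by (simp add: v_def power_divide)
      have "norm (g n x - g n y) = q ^ n * norm (v y ^ n - v x ^ n)"
        using q by (simp add: g_v that 3 norm_mult norm_power flip: right_diff_distrib)
      also have "\<dots> \<le> q ^ n * (real n * norm (v y - v x))"
        using q by (intro mult_left_mono norm_power_diff v that 3) auto
      also have "norm (v y - v x) = \<bar>u x - u y\<bar> / q"
        using q unfolding v_def of_real_diff[symmetric] norm_of_real
        by (simp add: abs_minus_commute flip: diff_divide_distrib)
      also have "q ^ n * (real n * (\<bar>u x - u y\<bar> / q)) \<le> q ^ n * (real n * (L * norm (x - y) / q))"
        using q u_lip[OF that] by (intro mult_left_mono divide_right_mono) auto
      also have "\<dots> = L / q * (real n * q ^ n) * norm (x - y)" by simp
      also have "\<dots> \<le> K n * norm (x - y)"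
        using q d by (intro mult_right_mono) (auto simp: K_def)
      finally show ?thesis .
    qed
  qed
  define T where "T = (\<Sum>j<k. \<Sum>n. norm (s j (Suc n) - s j n))"
  have g_fun: "g n \<in> functions_on \<sigma>" for n
    using p by (auto simp: functions_on_def g_def P_def indicator_def)
  have gBV: "g n \<in> BV \<sigma>" for n
    by (rule BV_norm_le(1)[OF g_fun lipschitz_ray_regular(1)[OF g_lip]])
  have g_norm: "BV_norm \<sigma> (g n) \<le> (1 + C) * (q ^ n + K n * T)" for n
  proof -
    have "BV_norm \<sigma> (g n) \<le> (1 + C) * ray_norm k s (g n)"
      by (rule BV_norm_le(2)[OF g_fun lipschitz_ray_regular(1)[OF g_lip]])
    also have "ray_norm k s (g n) \<le> norm (g n 0) + K n * T"
      unfolding T_def by (rule lipschitz_ray_regular(2)[OF g_lip])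
    also have "\<dots> \<le> q ^ n + K n * T" using g_small[OF zero_mem] by simp
    finally show ?thesis using C_nonneg by (simp add: mult_left_mono)
  qed
  have qn: "(\<lambda>n. q ^ n) \<longlonglongrightarrow> 0" using q by (intro LIMSEQ_power_zero) auto
  have nqn: "(\<lambda>n. real n * q ^ n) \<longlonglongrightarrow> 0"
    using powser_times_n_limit_0[of q] q by simp
  have "K \<longlonglongrightarrow> L / q * 0 + 0 / d"
    unfolding K_def by (intro tendsto_intros qn nqn) (use d in auto)
  then have "(\<lambda>n. (1 + C) * (q ^ n + K n * T)) \<longlonglongrightarrow> (1 + C) * (0 + (L / q * 0 + 0 / d) * T)"
    by (intro tendsto_intros qn)
  then have small: "(\<lambda>n. (1 + C) * (q ^ n + K n * T)) \<longlonglongrightarrow> 0" by simp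
  show ?thesis
  proof (rule AC_closed)
    have "indicator {p} = (\<lambda>z. g 0 z + P 0 z)" by (simp add: g_def fun_eq_iff)
    also have "\<dots> \<in> BV \<sigma>" using gBV P AC_subset_BV by (intro BV_add) auto
    finally show "indicator {p} \<in> BV \<sigma>" .
    fix e :: real assume "0 < e"
    with small have "eventually (\<lambda>n. (1 + C) * (q ^ n + K n * T) < e) sequentially"
      by (rule order_tendstoD)
    then obtain n where "(1 + C) * (q ^ n + K n * T) < e" by (auto simp: eventually_sequentially)
    moreover have "g n = (\<lambda>z. indicator {p} z - P n z)" by (simp add: g_def fun_eq_iff)
    ultimately have "BV_norm \<sigma> (\<lambda>z. indicator {p} z - P n z) < e" using g_norm[of n] by simp
    with P show "\<exists>h\<in>AC \<sigma>. BV_norm \<sigma> (\<lambda>z. indicator {p} z - h z) < e" by blast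
  qed
qed

lemma finite_support_AC:
  assumes "finite A" "A \<subseteq> \<sigma> - {0}"
  shows "(\<lambda>z. if z \<in> A then h z else 0) \<in> AC \<sigma>"
proof -
  have "(\<lambda>z. \<Sum>p\<in>A. h p * indicator {p} z) \<in> AC \<sigma>"
    using assms
  proof (induction rule: finite_induct)
    case empty
    show ?case using polynomial_AC[OF plane_polynomial_const[of 0]] by simp
  next
    case (insert p A)
    then have "(\<lambda>z. h p * indicator {p} z + (\<Sum>p\<in>A. h p * indicator {p} z)) \<in> AC \<sigma>"
      by (intro AC_add AC_scale indicator_AC) auto
    then show ?case by (simp only: sum.insert[OF insert.hyps] not_False_eq_True)
  qed
  also have "(\<lambda>z. \<Sum>p\<in>A. h p * indicator {p} z) = (\<lambda>z. if z \<in> A then h z else 0)"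
  proof
    fix z
    have "(\<Sum>p\<in>A. h p * indicator {p} z) = (\<Sum>p\<in>A. if p = z then h z else 0)"
      by (intro sum.cong) (auto simp: indicator_def)
    then show "(\<Sum>p\<in>A. h p * indicator {p} z) = (if z \<in> A then h z else 0)"
      using assms by simp
  qed
  finally show ?thesis .
qed

text \<open>The approximants agree with \<open>f\<close> on the first points of each sequence and are constant equal to
  \<open>f 0\<close> elsewhere. They lie in \<open>AC\<close>, as a constant plus a finitely supported function, and their
  distance to \<open>f\<close> is governed by the tails of the convergent sums of jumps.\<close>

lemma ray_regular_AC:
  assumes f: "f \<in> functions_on \<sigma>" and reg: "ray_regular k s f"
  shows "f \<in> AC \<sigma>"
proof (rule AC_closed)
  show "f \<in> BV \<sigma>" using f reg by (rule BV_norm_le)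
  fix e :: real assume "0 < e"
  define A where "A N = (\<Union>j<k. s j ` {..<Suc N})" for N
  \<comment> \<open>the error of the approximant that agrees with \<open>f\<close> on \<open>A N\<close>; on each
    sequence its only jumps are one of size tending to \<open>0\<close> at index \<open>N\<close> and those of \<open>f\<close> further on\<close>
  define g where "g N z = (if z \<in> \<sigma> \<and> z \<notin> A N then f z - f 0 else 0)" for N z
  define E where "E N = (\<Sum>j<k. (\<Sum>n. step s f j (n + N)) + norm (f (s j (Suc N)) - f 0))" for N
  have sf: "summable (step s f j)" and lf: "(\<lambda>n. f (s j n)) \<longlonglongrightarrow> f 0" if "j < k" for j
    using reg that by (auto simp: ray_regular_def)
  have A_iff: "s j n \<in> A N \<longleftrightarrow> n \<le> N" if "j < k" for j n N
  proof
    assume "s j n \<in> A N"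
    then obtain i m where "i < k" "m \<le> N" "s j n = s i m" by (auto simp: A_def less_Suc_eq_le)
    with inj[OF that] show "n \<le> N" by metis
  qed (use that in \<open>auto simp: A_def less_Suc_eq_le intro!: bexI[of _ j] imageI\<close>)
  have A: "finite (A N)" "A N \<subseteq> \<sigma> - {0}" for N
    using mem nonzero by (auto simp: A_def)
  have g_s: "g N (s j n) = (if n \<le> N then 0 else f (s j n) - f 0)" if "j < k" for N j n
    using mem[OF that] by (simp add: g_def A_iff that)
  have g_0: "g N 0 = 0" for N using A by (auto simp: g_def)
  have g_fun: "g N \<in> functions_on \<sigma>" for N by (simp add: functions_on_def g_def)
  have g_before: "step s (g N) j n = 0" if "j < k" "n < N" for N j n
    using that by (simp add: step_def g_s)
  have g_at: "step s (g N) j N = norm (f (s j (Suc N)) - f 0)" if "j < k" for N j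
    using that by (simp add: step_def g_s)
  have g_after: "step s (g N) j n = step s f j n" if "j < k" "N < n" for N j n
    using that by (simp add: step_def g_s)
  have sg': "(\<lambda>n. step s (g N) j (n + Suc N)) = (\<lambda>n. step s f j (n + Suc N))" if "j < k" for N j
    using that by (simp add: g_after fun_eq_iff)
  have sfN: "summable (\<lambda>n. step s f j (n + N))" if "j < k" for j N
    using sf[OF that] by (simp only: summable_iff_shift)
  have sg: "summable (step s (g N) j)" if "j < k" for N j
    using sfN[OF that, of "Suc N"] unfolding sg'[OF that, symmetric] by (simp only: summable_iff_shift)
  have g_sum: "(\<Sum>n. step s (g N) j n) \<le> (\<Sum>n. step s f j (n + N)) + norm (f (s j (Suc N)) - f 0)"
    if "j < k" for N j
  proof -
    have "(\<Sum>n. step s (g N) j n)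
        = (\<Sum>n. step s (g N) j (n + Suc N)) + (\<Sum>n<Suc N. step s (g N) j n)"
      by (rule suminf_split_initial_segment[OF sg[OF that]])
    also have "(\<Sum>n<Suc N. step s (g N) j n) = norm (f (s j (Suc N)) - f 0)"
      using that by (simp add: g_before g_at)
    also have "(\<Sum>n. step s (g N) j (n + Suc N)) = (\<Sum>n. step s f j (Suc n + N))"
      unfolding sg'[OF that] by simp
    also have "\<dots> \<le> (\<Sum>n. step s f j (n + N))"
      using suminf_split_head[OF sfN[OF that, of N]] step_nonneg[of s f j N] by simp
    finally show ?thesis by simp
  qed
  have g_lim: "(\<lambda>n. g N (s j n)) \<longlonglongrightarrow> g N 0" if "j < k" for N j
  proof -
    have "(\<lambda>n. f (s j n) - f 0) \<longlonglongrightarrow> 0" using lf[OF that] by (rule LIM_zero)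
    moreover have "eventually (\<lambda>n. f (s j n) - f 0 = g N (s j n)) sequentially"
      using eventually_gt_at_top[of N] by eventually_elim (simp add: g_s that)
    ultimately show ?thesis by (simp add: g_0 Lim_transform_eventually)
  qed
  have g_reg: "ray_regular k s (g N)" for N using sg g_lim by (simp add: ray_regular_def)
  have "BV_norm \<sigma> (g N) \<le> (1 + C) * E N" for N
  proof -
    have "BV_norm \<sigma> (g N) \<le> (1 + C) * ray_norm k s (g N)" using g_fun g_reg by (rule BV_norm_le)
    also have "\<dots> \<le> (1 + C) * E N"
      unfolding ray_norm_def E_def using C_nonneg g_sum
      by (intro mult_left_mono) (auto simp: g_0 intro: sum_mono)
    finally show ?thesis .
  qed
  moreover have "(\<lambda>N. (1 + C) * E N) \<longlonglongrightarrow> (1 + C) * (\<Sum>j<k. 0 + 0)"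
    unfolding E_def
  proof (intro tendsto_mult tendsto_const tendsto_sum tendsto_add)
    fix j assume "j \<in> {..<k}"
    then have j: "j < k" by simp
    show "(\<lambda>N. \<Sum>n. step s f j (n + N)) \<longlonglongrightarrow> 0"
    proof -
      have "(\<lambda>N. suminf (step s f j) - sum (step s f j) {..<N}) \<longlonglongrightarrow> suminf (step s f j) - suminf (step s f j)"
        by (intro tendsto_diff tendsto_const summable_LIMSEQ sf j)
      then show ?thesis by (simp add: suminf_minus_initial_segment[OF sf[OF j]])
    qed
    show "(\<lambda>N. norm (f (s j (Suc N)) - f 0)) \<longlonglongrightarrow> 0"
      by (intro tendsto_norm_zero LIM_zero LIMSEQ_Suc lf j)
  qed
  then have "eventually (\<lambda>N. (1 + C) * E N < e) sequentially"
    using \<open>0 < e\<close> by (intro order_tendstoD(2)) auto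
  then obtain N where "(1 + C) * E N < e" by (auto simp: eventually_sequentially)
  ultimately have "BV_norm \<sigma> (g N) < e" by (rule le_less_trans)
  moreover define h where "h z = (if z \<in> \<sigma> then f 0 else 0) + (if z \<in> A N then f z - f 0 else 0)" for z
  have "h \<in> AC \<sigma>"
    unfolding h_def using A by (intro AC_add polynomial_AC plane_polynomial_const finite_support_AC)
  moreover have "g N = (\<lambda>z. f z - h z)"
    using f A(2)[of N] by (auto simp: g_def h_def functions_on_def fun_eq_iff)
  ultimately show "\<exists>h\<in>AC \<sigma>. BV_norm \<sigma> (\<lambda>z. f z - h z) < e" by auto
qed

text \<open>Membership in \<open>AC\<close> thus depends only on the values of \<open>f\<close> along the numbered sequences, not on
  where the points lie in the plane.\<close>

theorem AC_iff_ray_regular: "f \<in> AC \<sigma> \<longleftrightarrow> f \<in> functions_on \<sigma> \<and> ray_regular k s f"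
  using AC_ray_regular ray_regular_AC AC_subset_BV by (auto simp: BV_def)

lemma AC_mult: "f \<in> AC \<sigma> \<Longrightarrow> g \<in> AC \<sigma> \<Longrightarrow> (\<lambda>z. f z * g z) \<in> AC \<sigma>"
  by (auto simp: AC_iff_ray_regular functions_on_def ray_regular_mult)

end

section \<open>Ray sets as families of sequences\<close>

lemma ray_Int:
  assumes "ray \<theta> \<noteq> ray \<phi>"
  shows "ray \<theta> \<inter> ray \<phi> = {0}"
  using assms zero_mem_ray ray_eq by blast

text \<open>Nonzero points lie on at most one of the rays, and the finitely many points outside all of them are
  put in front of the sequence of the first ray.\<close>

theorem ray_set_enumeration:
  assumes "ray_set k \<sigma>" and "0 < k"
  shows "\<exists>s C. ray_enumeration k \<sigma> s C"
proof -
  from assms obtain \<theta> :: "nat \<Rightarrow> real" where C_set: "C_set \<sigma>"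
    and inj: "inj_on (\<lambda>j. ray (\<theta> j)) {1..k}"
    and inf: "\<And>j. j \<in> {1..k} \<Longrightarrow> infinite (\<sigma> \<inter> ray (\<theta> j))"
    and fin: "finite (\<sigma> - (\<Union>j\<in>{1..k}. \<sigma> \<inter> ray (\<theta> j)))"
    by (auto simp: ray_set_def)
  define F where "F = \<sigma> - (\<Union>j\<in>{1..k}. \<sigma> \<inter> ray (\<theta> j))"
  define G where "G j = (if j = 0 then F else {})" for j :: nat
  define P where "P j = G j \<union> (\<sigma> \<inter> ray (\<theta> (Suc j)) - {0})" for j
  define Q where "Q j s C \<longleftrightarrow> bij_betw s (UNIV :: nat set) (P j) \<and> s \<longlonglongrightarrow> 0 \<and>
    summable (\<lambda>n. norm (s (Suc n) - s n)) \<and> 0 \<le> C \<and>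
    (\<forall>f\<in>BV \<sigma>. \<forall>N. (\<Sum>n<N. norm (f (s (Suc n)) - f (s n))) \<le> C * BV_norm \<sigma> f) \<and>
    (\<forall>n. var_le \<sigma> (indicator (s ` {..n})) C)" for j s C
  have "\<exists>s C. Q j s C" if "j < k" for j
    unfolding Q_def P_def
  proof (rule ray_sequence[OF C_set])
    have j: "Suc j \<in> {1..k}" using that by simp
    then show "infinite (\<sigma> \<inter> ray (\<theta> (Suc j)))" by (rule inf)
    show "finite (G j)" "G j \<subseteq> \<sigma>" using fin by (auto simp: G_def F_def)
    show "G j \<inter> ray (\<theta> (Suc j)) = {}" using j by (auto simp: G_def F_def)
  qed
  then obtain s C where Q: "\<And>j. j < k \<Longrightarrow> Q j (s j) (C j)" by metis
  have s_bij: "bij_betw (s j) UNIV (P j)" and s_lim: "s j \<longlonglongrightarrow> 0"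
    and s_sum: "summable (\<lambda>n. norm (s j (Suc n) - s j n))" and s_nonneg: "0 \<le> C j"
    and s_step: "\<forall>f\<in>BV \<sigma>. \<forall>N. (\<Sum>n<N. norm (f (s j (Suc n)) - f (s j n))) \<le> C j * BV_norm \<sigma> f"
    and s_var: "\<forall>n. var_le \<sigma> (indicator (s j ` {..n})) (C j)" if "j < k" for j
    using Q[OF that] unfolding Q_def by simp_all
  define D where "D = (\<Sum>j<k. C j)"
  have C_le: "C j \<le> D" if "j < k" for j
    unfolding D_def using s_nonneg that by (intro member_le_sum) auto
  have sP: "s j n \<in> P j" if "j < k" for j n
    using s_bij[OF that] UNIV_I by (rule bij_betw_apply)
  have disj: "i = j" if "i < k" "j < k" "z \<in> P i" "z \<in> P j" for i j z
  proof (rule ccontr)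
    assume "i \<noteq> j"
    have "ray (\<theta> (Suc i)) \<noteq> ray (\<theta> (Suc j))"
      using inj_onD[OF inj, of "Suc i" "Suc j"] that \<open>i \<noteq> j\<close> by auto
    then have "ray (\<theta> (Suc i)) \<inter> ray (\<theta> (Suc j)) = {0}" by (rule ray_Int)
    moreover have "z \<notin> F \<or> z \<notin> ray (\<theta> (Suc m))" if "m < k" for m
      using that by (auto simp: F_def)
    ultimately show False using that \<open>i \<noteq> j\<close> by (auto simp: P_def G_def split: if_splits)
  qed
  have "ray_enumeration k \<sigma> s D"
  proof
    show "C_set \<sigma>" by fact
    fix j n assume j: "j < k"
    have "F \<subseteq> \<sigma> - {0}"
      using \<open>0 < k\<close> zero_mem_ray[of "\<theta> 1"] by (auto simp: F_def intro!: bexI[of _ 1])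
    then show "s j n \<in> \<sigma>" "s j n \<noteq> 0"
      using sP[OF j, of n] by (auto simp: P_def G_def split: if_splits)
  next
    fix i j m n assume *: "i < k" "j < k" "s i m = s j n"
    then have "i = j" using disj sP by metis
    moreover have "inj (s j)" using s_bij[OF *(2)] by (simp add: bij_betw_def)
    ultimately show "i = j \<and> m = n" using * by (auto dest: injD)
  next
    fix z assume z: "z \<in> \<sigma>" "z \<noteq> 0"
    have "\<exists>j<k. z \<in> P j"
    proof (cases "z \<in> F")
      case True
      with \<open>0 < k\<close> show ?thesis by (auto simp: P_def G_def)
    next
      case False
      then obtain j where "j \<in> {1..k}" "z \<in> ray (\<theta> j)" using z by (auto simp: F_def)
      with z show ?thesis by (intro exI[of _ "j - 1"]) (auto simp: P_def)
    qed
    then obtain j where j: "j < k" "z \<in> P j" by blast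
    with s_bij[OF j(1)] have "z \<in> range (s j)" by (simp add: bij_betw_def)
    with j show "\<exists>j<k. \<exists>n. z = s j n" by blast
  next
    show "0 \<le> D" unfolding D_def using s_nonneg by (intro sum_nonneg) auto
  next
    fix j assume "j < k"
    then show "s j \<longlonglongrightarrow> 0" "summable (\<lambda>n. norm (s j (Suc n) - s j n))" by (rule s_lim, rule s_sum)
  next
    fix j f N assume j: "j < k" and f: "f \<in> BV \<sigma>"
    then have "(\<Sum>n<N. step s f j n) \<le> C j * BV_norm \<sigma> f"
      using s_step[OF j] by (simp add: step_def)
    also have "\<dots> \<le> D * BV_norm \<sigma> f" by (intro mult_right_mono BV_norm_nonneg C_le j)
    finally show "(\<Sum>n<N. step s f j n) \<le> D * BV_norm \<sigma> f" .
  next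
    fix j n assume "j < k"
    with s_var C_le show "var_le \<sigma> (indicator (s j ` {..n})) D" by (blast intro: var_le_mono)
  qed
  then show ?thesis by blast
qed

section \<open>Isomorphisms between algebras of absolutely continuous functions\<close>

lemma Metric_space_AC: "Metric_space (AC \<sigma>) (\<lambda>f g. BV_norm \<sigma> (\<lambda>z. f z - g z))"
  using Metric_space_BV AC_subset_BV by (rule Metric_space.subspace)

lemma AC_continuous_map_iff:
  "continuous_map (norm_topology (AC \<sigma>) (BV_norm \<sigma>)) (norm_topology (AC \<tau>) (BV_norm \<tau>)) \<Phi> \<longleftrightarrow>
     \<Phi> ` AC \<sigma> \<subseteq> AC \<tau> \<and> (\<forall>f\<in>AC \<sigma>. \<forall>e>0. \<exists>d>0. \<forall>g. g \<in> AC \<sigma> \<and> BV_norm \<sigma> (\<lambda>z. f z - g z) < d \<longrightarrow>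
       BV_norm \<tau> (\<lambda>z. \<Phi> f z - \<Phi> g z) < e)"
  unfolding norm_topology_def by (rule Metric_space.metric_continuous_map[OF Metric_space_AC Metric_space_AC])

lemma topspace_norm_topology_AC: "topspace (norm_topology (AC \<sigma>) (BV_norm \<sigma>)) = AC \<sigma>"
  unfolding norm_topology_def by (rule Metric_space.topspace_mtopology[OF Metric_space_AC])

definition relabel :: "complex set \<Rightarrow> (complex \<Rightarrow> complex) \<Rightarrow> (complex \<Rightarrow> complex) \<Rightarrow> complex \<Rightarrow> complex" where
  "relabel \<tau> \<phi> f w = (if w \<in> \<tau> then f (\<phi> w) else 0)"

text \<open>A map that respects the numbering of the points preserves jumps, hence \<open>ray_norm\<close>, which is
  equivalent to the norm on both sides.\<close>

lemma relabel_AC: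
  assumes "ray_enumeration k \<sigma> s C" and "ray_enumeration k \<tau> t D"
    and \<phi>0: "\<phi> 0 = 0" and \<phi>: "\<And>j n. j < k \<Longrightarrow> \<phi> (t j n) = s j n"
  shows "f \<in> AC \<sigma> \<Longrightarrow> relabel \<tau> \<phi> f \<in> AC \<tau>"
    and "continuous_map (norm_topology (AC \<sigma>) (BV_norm \<sigma>)) (norm_topology (AC \<tau>) (BV_norm \<tau>)) (relabel \<tau> \<phi>)"
proof -
  interpret S: ray_enumeration k \<sigma> s C by fact
  interpret T: ray_enumeration k \<tau> t D by fact
  let ?\<Phi> = "relabel \<tau> \<phi>"
  have fun_on: "?\<Phi> f \<in> functions_on \<tau>" for f by (simp add: relabel_def functions_on_def)
  have at: "?\<Phi> f (t j n) = f (s j n)" if "j < k" for f j n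
    using T.mem[OF that] \<phi>[OF that] by (simp add: relabel_def)
  have at0: "?\<Phi> f 0 = f 0" for f using T.zero_mem \<phi>0 by (simp add: relabel_def)
  have st: "step t (?\<Phi> f) j = step s f j" if "j < k" for f j
    using that by (simp add: step_def at fun_eq_iff)
  have reg: "ray_regular k t (?\<Phi> f) \<longleftrightarrow> ray_regular k s f" for f
    by (simp add: ray_regular_def st at at0)
  have norm: "ray_norm k t (?\<Phi> f) = ray_norm k s f" for f
    by (simp add: ray_norm_def st at0)
  show AC: "?\<Phi> f \<in> AC \<tau>" if "f \<in> AC \<sigma>" for f
    using that by (simp add: S.AC_iff_ray_regular T.AC_iff_ray_regular fun_on reg)
  have bound: "BV_norm \<tau> (?\<Phi> f) \<le> ((1 + D) * (1 + real k * C)) * BV_norm \<sigma> f" if "f \<in> AC \<sigma>" for f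
  proof -
    have "BV_norm \<tau> (?\<Phi> f) \<le> (1 + D) * ray_norm k s f"
      using T.BV_norm_le(2)[OF fun_on, of f] that by (simp add: S.AC_iff_ray_regular reg norm)
    also have "\<dots> \<le> (1 + D) * ((1 + real k * C) * BV_norm \<sigma> f)"
      using that AC_subset_BV T.C_nonneg by (intro mult_left_mono S.ray_norm_le(2)) auto
    finally show ?thesis by (simp add: mult.assoc)
  qed
  define K where "K = (1 + D) * (1 + real k * C)"
  have K: "0 < K" unfolding K_def using S.C_nonneg T.C_nonneg
    by (intro mult_pos_pos add_pos_nonneg) auto
  show "continuous_map (norm_topology (AC \<sigma>) (BV_norm \<sigma>)) (norm_topology (AC \<tau>) (BV_norm \<tau>)) ?\<Phi>"
    unfolding AC_continuous_map_iff
  proof (intro conjI ballI allI impI)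
    show "?\<Phi> ` AC \<sigma> \<subseteq> AC \<tau>" using AC by auto
    fix f and e :: real assume f: "f \<in> AC \<sigma>" and e: "0 < e"
    have "BV_norm \<tau> (\<lambda>z. ?\<Phi> f z - ?\<Phi> g z) < e"
      if g: "g \<in> AC \<sigma>" "BV_norm \<sigma> (\<lambda>z. f z - g z) < e / K" for g
    proof -
      have "(\<lambda>z. f z - g z) \<in> AC \<sigma>"
        using AC_add[OF f AC_scale[OF g(1), of "- 1"]] by simp
      from bound[OF this] have "BV_norm \<tau> (?\<Phi> (\<lambda>z. f z - g z)) \<le> K * BV_norm \<sigma> (\<lambda>z. f z - g z)"
        by (simp add: K_def)
      also have "\<dots> < e" using g(2) K by (simp add: pos_less_divide_eq mult.commute)
      also have "?\<Phi> (\<lambda>z. f z - g z) = (\<lambda>z. ?\<Phi> f z - ?\<Phi> g z)" by (simp add: relabel_def fun_eq_iff)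
      finally show ?thesis .
    qed
    then show "\<exists>d>0. \<forall>g. g \<in> AC \<sigma> \<and> BV_norm \<sigma> (\<lambda>z. f z - g z) < d \<longrightarrow>
       BV_norm \<tau> (\<lambda>z. ?\<Phi> f z - ?\<Phi> g z) < e"
      using e K by (intro exI[of _ "e / K"]) auto
  qed
qed

lemma (in ray_enumeration) exists_relabelling:
  fixes t :: "nat \<Rightarrow> nat \<Rightarrow> complex"
  obtains \<phi> :: "complex \<Rightarrow> complex" where "\<phi> 0 = 0" and "\<And>j n. j < k \<Longrightarrow> \<phi> (s j n) = t j n"
proof -
  have "\<exists>w. (z = 0 \<longrightarrow> w = 0) \<and> (\<forall>j<k. \<forall>n. z = s j n \<longrightarrow> w = t j n)" for z
  proof (cases "\<exists>j<k. \<exists>n. z = s j n")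
    case True
    then obtain j n where jn: "j < k" "z = s j n" by blast
    have "t j n = t i m" if "i < k" "z = s i m" for i m
    proof -
      have "s i m = s j n" using jn(2) that(2) by simp
      from inj[OF that(1) jn(1) this] show ?thesis by simp
    qed
    moreover have "z \<noteq> 0" using jn nonzero by simp
    ultimately show ?thesis by (intro exI[of _ "t j n"]) auto
  next
    case False
    then show ?thesis by (intro exI[of _ 0]) auto
  qed
  then have "\<exists>\<phi>. \<forall>z. (z = 0 \<longrightarrow> \<phi> z = 0) \<and> (\<forall>j<k. \<forall>n. z = s j n \<longrightarrow> \<phi> z = t j n)"
    by (intro choice allI)
  then obtain \<phi> where "\<forall>z. (z = 0 \<longrightarrow> \<phi> z = 0) \<and> (\<forall>j<k. \<forall>n. z = s j n \<longrightarrow> \<phi> z = t j n)" ..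
  then show thesis by (intro that[of \<phi>]) auto
qed

theorem ray_enumeration_isomorphic:
  assumes S: "ray_enumeration k \<sigma> s C" and T: "ray_enumeration k \<tau> t D"
  shows "AC_isomorphic \<sigma> \<tau>"
proof -
  interpret S: ray_enumeration k \<sigma> s C by fact
  interpret T: ray_enumeration k \<tau> t D by fact
  obtain \<phi> where \<phi>: "\<phi> 0 = 0" "\<And>j n. j < k \<Longrightarrow> \<phi> (t j n) = s j n"
    using T.exists_relabelling[of s] by blast
  obtain \<psi> where \<psi>: "\<psi> 0 = 0" "\<And>j n. j < k \<Longrightarrow> \<psi> (s j n) = t j n"
    using S.exists_relabelling[of t] by blast
  have \<psi>\<phi>: "\<psi> z \<in> \<tau> \<and> \<phi> (\<psi> z) = z" if "z \<in> \<sigma>" for z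
    using that by (cases rule: S.cases_points) (auto simp: \<phi> \<psi> T.zero_mem T.mem)
  have \<phi>\<psi>: "\<phi> z \<in> \<sigma> \<and> \<psi> (\<phi> z) = z" if "z \<in> \<tau>" for z
    using that by (cases rule: T.cases_points) (auto simp: \<phi> \<psi> S.zero_mem S.mem)
  have inv1: "relabel \<sigma> \<psi> (relabel \<tau> \<phi> f) = f" if "f \<in> AC \<sigma>" for f
    using that \<psi>\<phi> by (auto simp: S.AC_iff_ray_regular functions_on_def relabel_def fun_eq_iff)
  have inv2: "relabel \<tau> \<phi> (relabel \<sigma> \<psi> f) = f" if "f \<in> AC \<tau>" for f
    using that \<phi>\<psi> by (auto simp: T.AC_iff_ray_regular functions_on_def relabel_def fun_eq_iff)
  have \<Phi>: "f \<in> AC \<sigma> \<Longrightarrow> relabel \<tau> \<phi> f \<in> AC \<tau>"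
    "continuous_map (norm_topology (AC \<sigma>) (BV_norm \<sigma>)) (norm_topology (AC \<tau>) (BV_norm \<tau>)) (relabel \<tau> \<phi>)" for f
    using relabel_AC[OF S T, of \<phi>] \<phi> by auto
  have \<Psi>: "f \<in> AC \<tau> \<Longrightarrow> relabel \<sigma> \<psi> f \<in> AC \<sigma>"
    "continuous_map (norm_topology (AC \<tau>) (BV_norm \<tau>)) (norm_topology (AC \<sigma>) (BV_norm \<sigma>)) (relabel \<sigma> \<psi>)" for f
    using relabel_AC[OF T S, of \<psi>] \<psi> by auto
  have bij: "bij_betw (relabel \<tau> \<phi>) (AC \<sigma>) (AC \<tau>)"
    by (rule bij_betwI[of _ _ _ "relabel \<sigma> \<psi>"]) (auto simp: \<Phi>(1) \<Psi>(1) inv1 inv2)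
  have "continuous_map (norm_topology (AC \<tau>) (BV_norm \<tau>)) (norm_topology (AC \<sigma>) (BV_norm \<sigma>))
      (inv_into (AC \<sigma>) (relabel \<tau> \<phi>))"
  proof (rule continuous_map_eq[OF \<Psi>(2)])
    fix f assume "f \<in> topspace (norm_topology (AC \<tau>) (BV_norm \<tau>))"
    then have f: "f \<in> AC \<tau>" by (simp add: topspace_norm_topology_AC)
    show "relabel \<sigma> \<psi> f = inv_into (AC \<sigma>) (relabel \<tau> \<phi>) f"
      using bij_betw_inv_into_left[OF bij \<Psi>(1)[OF f]] inv2[OF f] by simp
  qed
  moreover have "relabel \<tau> \<phi> (\<lambda>z. f z + g z) = (\<lambda>z. relabel \<tau> \<phi> f z + relabel \<tau> \<phi> g z)"
    and "relabel \<tau> \<phi> (\<lambda>z. f z * g z) = (\<lambda>z. relabel \<tau> \<phi> f z * relabel \<tau> \<phi> g z)"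
    and "relabel \<tau> \<phi> (\<lambda>z. c * f z) = (\<lambda>z. c * relabel \<tau> \<phi> f z)" for f g c
    by (auto simp: relabel_def fun_eq_iff)
  ultimately show ?thesis
    unfolding AC_isomorphic_def banach_algebra_isomorphic_def
    using bij \<Phi>(2) by (intro exI[of _ "relabel \<tau> \<phi>"]) auto
qed

section \<open>The number of rays is an invariant\<close>

text \<open>Homogeneity of the norm in the direction that \<open>BV_scale\<close> does not give.\<close>

lemma BV_norm_le_scaled:
  assumes "f \<in> BV \<sigma>" "c \<noteq> 0"
  shows "BV_norm \<sigma> f \<le> BV_norm \<sigma> (\<lambda>z. c * f z) / norm c"
proof -
  have "BV_norm \<sigma> (\<lambda>z. inverse c * (c * f z)) \<le> norm (inverse c) * BV_norm \<sigma> (\<lambda>z. c * f z)"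
    using assms by (intro BV_scale)
  moreover have "(\<lambda>z. inverse c * (c * f z)) = f" using assms(2) by (simp add: fun_eq_iff)
  ultimately show ?thesis by (simp add: norm_inverse divide_inverse mult.commute)
qed

lemma indicator_insert:
  "a \<notin> A \<Longrightarrow> indicator (insert a A) = (\<lambda>z. indicator {a} z + indicator A z :: complex)"
  by (auto simp: indicator_def fun_eq_iff)

text \<open>A sequence with values in \<open>{0, 1}\<close> and summable jumps jumps only finitely often.\<close>

lemma eventually_constant_set:
  fixes A :: "'a set"
  assumes "summable (\<lambda>n. norm (indicator A (t (Suc n)) - indicator A (t n) :: complex))"
  shows "\<exists>m. \<forall>n\<ge>m. t n \<in> A \<longleftrightarrow> t m \<in> A"
proof -
  have "eventually (\<lambda>n. norm (indicator A (t (Suc n)) - indicator A (t n) :: complex) < 1) sequentially"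
    using summable_LIMSEQ_zero[OF assms] by (rule order_tendstoD) simp
  then obtain m where m: "\<And>n. m \<le> n \<Longrightarrow> norm (indicator A (t (Suc n)) - indicator A (t n) :: complex) < 1"
    by (auto simp: eventually_sequentially)
  have step: "t (Suc n) \<in> A \<longleftrightarrow> t n \<in> A" if "m \<le> n" for n
    using m[OF that] by (cases "t (Suc n) \<in> A"; cases "t n \<in> A") simp_all
  have "t n \<in> A \<longleftrightarrow> t m \<in> A" if "m \<le> n" for n
    using that by (induction n rule: dec_induct) (auto simp: step)
  then show ?thesis by blast
qed

text \<open>Indicators of nonzero points are the minimal idempotents, so the isomorphism moves them by an
  injective map \<open>h\<close> of the nonzero points. The initial segments of a sequence \<open>s j\<close> have bounded norm,
  so the indicators of their images under \<open>h\<close> are bounded too, which bounds the number of jumps of the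
  indicator of the whole image \<open>H j\<close> along each \<open>t i\<close>. Hence each \<open>t i\<close> is eventually inside or eventually
  outside \<open>H j\<close>. As \<open>H j\<close> is infinite, it contains a tail of some \<open>t i\<close>; and the sets \<open>H j\<close> being
  disjoint, different \<open>j\<close> need different \<open>i\<close>.\<close>

theorem ray_enumeration_isomorphic_le:
  assumes S: "ray_enumeration k \<sigma> s C" and T: "ray_enumeration l \<tau> t D" and "0 < l"
    and bij: "bij_betw \<Phi> (AC \<sigma>) (AC \<tau>)"
    and add: "\<And>f g. f \<in> AC \<sigma> \<Longrightarrow> g \<in> AC \<sigma> \<Longrightarrow> \<Phi> (\<lambda>z. f z + g z) = (\<lambda>z. \<Phi> f z + \<Phi> g z)"
    and scale: "\<And>c f. f \<in> AC \<sigma> \<Longrightarrow> \<Phi> (\<lambda>z. c * f z) = (\<lambda>z. c * \<Phi> f z)"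
    and mult: "\<And>f g. f \<in> AC \<sigma> \<Longrightarrow> g \<in> AC \<sigma> \<Longrightarrow> \<Phi> (\<lambda>z. f z * g z) = (\<lambda>z. \<Phi> f z * \<Phi> g z)"
    and cont: "continuous_map (norm_topology (AC \<sigma>) (BV_norm \<sigma>)) (norm_topology (AC \<tau>) (BV_norm \<tau>)) \<Phi>"
  shows "k \<le> l"
proof -
  interpret S: ray_enumeration k \<sigma> s C by fact
  interpret T: ray_enumeration l \<tau> t D by fact
  have in_AC: "\<Phi> f \<in> AC \<tau>" if "f \<in> AC \<sigma>" for f using bij that by (rule bij_betw_apply)
  have eqD: "f = g" if "f \<in> AC \<sigma>" "g \<in> AC \<sigma>" "\<Phi> f = \<Phi> g" for f g
    using bij that by (auto simp: bij_betw_def dest: inj_onD)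
  have zero_AC: "(\<lambda>z. 0) \<in> AC \<sigma>"
    using S.polynomial_AC[OF plane_polynomial_const[of 0]] by simp
  have \<Phi>_zero: "\<Phi> (\<lambda>z. 0) = (\<lambda>z. 0)" using scale[OF zero_AC, of 0] by simp
  have point: "\<exists>q. q \<in> \<tau> - {0} \<and> \<Phi> (indicator {p}) = indicator {q}" if "p \<in> \<sigma> - {0}" for p
  proof -
    let ?p = "indicator {p} :: complex \<Rightarrow> complex"
    define e where "e = \<Phi> ?p"
    have p: "?p \<in> AC \<sigma>" using that by (intro S.indicator_AC) auto
    have e: "e \<in> AC \<tau>" unfolding e_def using p by (rule in_AC)
    have idem: "e z * e z = e z" for z
    proof -
      have "(\<lambda>z. ?p z * ?p z) = ?p" by (auto simp: indicator_def fun_eq_iff)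
      then show ?thesis using mult[OF p p] by (metis e_def)
    qed
    \<comment> \<open>the support of \<open>e\<close> cannot be \<open>{0}\<close>, since \<open>e\<close> is continuous at \<open>0\<close>\<close>
    have "\<exists>q\<in>\<tau> - {0}. e q \<noteq> 0"
    proof (rule ccontr)
      assume "\<not> ?thesis"
      then have zero: "e z = 0" if "z \<in> \<tau> - {0}" for z using that by blast
      then have "(\<lambda>n. e (t 0 n)) = (\<lambda>n. 0)"
        using T.mem T.nonzero \<open>0 < l\<close> by (simp add: fun_eq_iff)
      moreover have "(\<lambda>n. e (t 0 n)) \<longlonglongrightarrow> e 0"
        using T.AC_ray_regular[OF e] \<open>0 < l\<close> by (simp add: ray_regular_def)
      ultimately have "e 0 = 0" by (simp add: LIMSEQ_const_iff)
      have "e z = 0" for z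
      proof (cases "z \<in> \<tau>")
        case True
        with zero \<open>e 0 = 0\<close> show ?thesis by (cases "z = 0") auto
      next
        case False
        with e show ?thesis by (simp add: T.AC_iff_ray_regular functions_on_def)
      qed
      then have "\<Phi> ?p = \<Phi> (\<lambda>z. 0)" by (simp add: \<Phi>_zero e_def fun_eq_iff)
      with p zero_AC have "?p = (\<lambda>z. 0)" by (rule eqD)
      then have "?p p = 0" by (rule fun_cong)
      then show False by simp
    qed
    then obtain q where q: "q \<in> \<tau> - {0}" "e q \<noteq> 0" by blast
    with idem[of q] have "e q = 1" by simp
    let ?q = "indicator {q} :: complex \<Rightarrow> complex"
    have "?q \<in> AC \<tau>" using q by (intro T.indicator_AC) auto
    then have "?q \<in> \<Phi> ` AC \<sigma>" using bij by (simp add: bij_betw_def)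
    then obtain u where u: "u \<in> AC \<sigma>" "\<Phi> u = ?q" by force
    \<comment> \<open>pulling \<open>?q * e = ?q\<close> back shows that the preimage \<open>u\<close> of \<open>?q\<close> is a multiple of the indicator of \<open>p\<close>\<close>
    have up: "(\<lambda>z. u z * ?p z) \<in> AC \<sigma>" using u(1) p by (rule S.AC_mult)
    have "\<Phi> (\<lambda>z. u z * ?p z) = (\<lambda>z. ?q z * e z)" using mult[OF u(1) p] by (simp add: u(2) e_def)
    also have "\<dots> = \<Phi> u" using \<open>e q = 1\<close> by (auto simp: u(2) indicator_def fun_eq_iff)
    finally have "\<Phi> (\<lambda>z. u z * ?p z) = \<Phi> u" .
    with up u(1) have "(\<lambda>z. u z * ?p z) = u" by (rule eqD)
    moreover have "(\<lambda>z. u z * ?p z) = (\<lambda>z. u p * ?p z)" by (auto simp: indicator_def fun_eq_iff)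
    ultimately have "u = (\<lambda>z. u p * ?p z)" by simp
    then have "?q = (\<lambda>z. u p * e z)" using scale[OF p, of "u p"] u(2) e_def by metis
    moreover from this have "u p = 1" using \<open>e q = 1\<close> by (metis indicator_simps(1) mult.right_neutral singletonI)
    ultimately have "\<Phi> ?p = ?q" by (simp add: e_def)
    with q show ?thesis by blast
  qed
  then have "\<exists>h. \<forall>p\<in>\<sigma> - {0}. h p \<in> \<tau> - {0} \<and> \<Phi> (indicator {p}) = indicator {h p}"
    by (intro bchoice ballI)
  then obtain h where h: "\<And>p. p \<in> \<sigma> - {0} \<Longrightarrow> h p \<in> \<tau> - {0}"
    and \<Phi>_h: "\<And>p. p \<in> \<sigma> - {0} \<Longrightarrow> \<Phi> (indicator {p}) = indicator {h p}" by blast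
  have h_inj: "inj_on h (\<sigma> - {0})"
  proof (rule inj_onI)
    fix p q assume pq: "p \<in> \<sigma> - {0}" "q \<in> \<sigma> - {0}" "h p = h q"
    have "\<Phi> (indicator {p}) = \<Phi> (indicator {q})" using pq by (simp only: \<Phi>_h)
    moreover have "indicator {p} \<in> AC \<sigma>" "indicator {q} \<in> AC \<sigma>"
      using pq by (auto intro: S.indicator_AC)
    ultimately have "indicator {p} = (indicator {q} :: complex \<Rightarrow> complex)" by (rule eqD[rotated 2])
    then have "indicator {p} p = (indicator {q} p :: complex)" by simp
    then show "p = q" by (auto simp: indicator_def split: if_splits)
  qed
  have \<Phi>_finite: "indicator F \<in> AC \<sigma> \<and> \<Phi> (indicator F) = indicator (h ` F)"
    if "finite F" "F \<subseteq> \<sigma> - {0}" for F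
    using that
  proof (induction rule: finite_induct)
    case empty
    then show ?case using zero_AC \<Phi>_zero by simp
  next
    case (insert p F)
    then have p: "p \<in> \<sigma> - {0}" and F: "indicator F \<in> AC \<sigma>" "\<Phi> (indicator F) = indicator (h ` F)" by auto
    have ip: "indicator {p} \<in> AC \<sigma>" using p by (intro S.indicator_AC) auto
    have "h p \<notin> h ` F" using insert h_inj by (auto dest: inj_onD)
    have eq: "indicator (insert p F) = (\<lambda>z. indicator {p} z + indicator F z :: complex)"
      using insert.hyps(2) by (rule indicator_insert)
    have "indicator (h ` insert p F) = (\<lambda>z. indicator {h p} z + indicator (h ` F) z :: complex)"
      unfolding image_insert using \<open>h p \<notin> h ` F\<close> by (rule indicator_insert)
    then have "\<Phi> (indicator (insert p F)) = indicator (h ` insert p F)"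
      unfolding eq using add[OF ip F(1)] F(2) \<Phi>_h[OF p] by simp
    moreover have "indicator (insert p F) \<in> AC \<sigma>" unfolding eq by (rule AC_add[OF ip F(1)])
    ultimately show ?case by blast
  qed
  have "\<forall>e>0. \<exists>d>0. \<forall>g. g \<in> AC \<sigma> \<and> BV_norm \<sigma> (\<lambda>z. 0 - g z) < d \<longrightarrow>
       BV_norm \<tau> (\<lambda>z. \<Phi> (\<lambda>z. 0) z - \<Phi> g z) < e"
    by (rule bspec[OF conjunct2[OF cont[unfolded AC_continuous_map_iff]] zero_AC])
  then obtain d where "0 < d" and d: "\<And>g. g \<in> AC \<sigma> \<Longrightarrow> BV_norm \<sigma> (\<lambda>z. - g z) < d \<Longrightarrow>
       BV_norm \<tau> (\<lambda>z. - \<Phi> g z) < 1"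
    by (auto simp: \<Phi>_zero dest!: spec[of _ 1])
  \<comment> \<open>scales the functions of norm at most \<open>1 + C\<close> into the ball of radius \<open>d\<close>\<close>
  define c where "c = d / (2 * (1 + C))"
  have c: "0 < c" "c * (1 + C) < d" using \<open>0 < d\<close> S.C_nonneg by (auto simp: c_def add_pos_nonneg field_simps)
  have bounded: "BV_norm \<tau> (\<Phi> f) \<le> 1 / c" if f: "f \<in> AC \<sigma>" "BV_norm \<sigma> f \<le> 1 + C" for f
  proof -
    let ?c = "complex_of_real (- c)"
    have "BV_norm \<sigma> (\<lambda>z. complex_of_real c * f z) \<le> norm (complex_of_real c) * BV_norm \<sigma> f"
      using f AC_subset_BV by (intro BV_scale) auto
    also have "\<dots> \<le> c * (1 + C)" using f c by simp
    also have "\<dots> < d" by fact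
    finally have "BV_norm \<sigma> (\<lambda>z. - (?c * f z)) < d" by simp
    then have "BV_norm \<tau> (\<lambda>z. - \<Phi> (\<lambda>z. ?c * f z) z) < 1" using AC_scale[OF f(1)] by (intro d)
    then have lt: "BV_norm \<tau> (\<lambda>z. complex_of_real c * \<Phi> f z) < 1"
      unfolding scale[OF f(1)] by simp
    have "BV_norm \<tau> (\<Phi> f) \<le> BV_norm \<tau> (\<lambda>z. complex_of_real c * \<Phi> f z) / norm (complex_of_real c)"
      using in_AC[OF f(1)] AC_subset_BV c by (intro BV_norm_le_scaled) auto
    also have "\<dots> \<le> 1 / c" using lt c by (auto intro: divide_right_mono)
    finally show ?thesis .
  qed
  define H where "H j = h ` range (s j)" for j
  have initial: "BV_norm \<tau> (indicator (h ` s j ` {..n})) \<le> 1 / c"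
    "indicator (h ` s j ` {..n}) \<in> BV \<tau>" if j: "j < k" for j n
  proof -
    have F: "finite (s j ` {..n})" "s j ` {..n} \<subseteq> \<sigma> - {0}" using S.mem S.nonzero j by auto
    have "BV_norm \<sigma> (indicator (s j ` {..n})) \<le> 1 + C"
      using F S.var_initial[OF j, of n] S.C_nonneg
      by (intro BV_I) (auto simp: functions_on_def indicator_def)
    with bounded \<Phi>_finite[OF F] show "BV_norm \<tau> (indicator (h ` s j ` {..n})) \<le> 1 / c" by metis
    show "indicator (h ` s j ` {..n}) \<in> BV \<tau>" using \<Phi>_finite[OF F] in_AC AC_subset_BV by (metis subsetD)
  qed
  have "summable (\<lambda>m. norm (indicator (H j) (t i (Suc m)) - indicator (H j) (t i m) :: complex))"
    if j: "j < k" and i: "i < l" for i j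
  proof (rule summableI_nonneg_bounded)
    fix N
    \<comment> \<open>among \<open>t i 0\<close>, ..., \<open>t i N\<close> the set \<open>H j\<close> cannot be told from the image of a long initial segment\<close>
    have "eventually (\<lambda>n. \<forall>m\<in>{..N}. t i m \<in> H j \<longleftrightarrow> t i m \<in> h ` s j ` {..n}) sequentially"
    proof (intro eventually_ball_finite ballI finite_atMost)
      fix m
      show "eventually (\<lambda>n. t i m \<in> H j \<longleftrightarrow> t i m \<in> h ` s j ` {..n}) sequentially"
      proof (cases "t i m \<in> H j")
        case True
        then obtain n0 where "t i m = h (s j n0)" by (auto simp: H_def)
        then have "t i m \<in> h ` s j ` {..n}" if "n0 \<le> n" for n using that by auto
        then show ?thesis using True by (auto simp: eventually_sequentially)
      next
        case False
        then have "t i m \<notin> h ` s j ` {..n}" for n by (auto simp: H_def)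
        with False show ?thesis by simp
      qed
    qed
    then obtain n where n: "\<And>m. m \<le> N \<Longrightarrow> t i m \<in> H j \<longleftrightarrow> t i m \<in> h ` s j ` {..n}"
      by (auto simp: eventually_sequentially)
    let ?B = "h ` s j ` {..n}"
    have "(\<Sum>m<N. norm (indicator (H j) (t i (Suc m)) - indicator (H j) (t i m) :: complex))
        = (\<Sum>m<N. step t (indicator ?B) i m)"
      unfolding step_def
    proof (rule sum.cong[OF refl])
      fix m assume "m \<in> {..<N}"
      with n[of m] n[of "Suc m"]
      show "norm (indicator (H j) (t i (Suc m)) - indicator (H j) (t i m) :: complex)
         = norm (indicator ?B (t i (Suc m)) - indicator ?B (t i m) :: complex)"
        by (simp add: indicator_def)
    qed
    also have "\<dots> \<le> D * BV_norm \<tau> (indicator ?B)" by (rule T.step_le[OF i initial(2)[OF j]])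
    also have "\<dots> \<le> D * (1 / c)" by (intro mult_left_mono initial(1)[OF j] T.C_nonneg)
    finally show "(\<Sum>m<N. norm (indicator (H j) (t i (Suc m)) - indicator (H j) (t i m) :: complex)) \<le> D * (1 / c)" .
  qed simp
  then have const: "\<exists>m. \<forall>n\<ge>m. t i n \<in> H j \<longleftrightarrow> t i m \<in> H j" if "j < k" "i < l" for i j
    using that by (intro eventually_constant_set)
  have tail: "\<exists>i<l. \<exists>m. \<forall>n\<ge>m. t i n \<in> H j" if j: "j < k" for j
  proof -
    have "inj (s j)" using S.inj[OF j j] by (auto intro: injI)
    moreover have "range (s j) \<subseteq> \<sigma> - {0}" using S.mem S.nonzero j by auto
    ultimately have "inj (h \<circ> s j)" using h_inj by (intro comp_inj_on) (auto intro: inj_on_subset)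
    then have "infinite (H j)" unfolding H_def image_comp by (rule range_inj_infinite)
    have H: "H j \<subseteq> \<tau> - {0}" using h \<open>range (s j) \<subseteq> \<sigma> - {0}\<close> by (auto simp: H_def)
    have "\<exists>i<l. infinite {m. t i m \<in> H j}"
    proof (rule ccontr)
      assume "\<not> ?thesis"
      then have "finite (\<Union>i<l. t i ` {m. t i m \<in> H j})" by auto
      moreover have "H j \<subseteq> (\<Union>i<l. t i ` {m. t i m \<in> H j})"
      proof
        fix w assume w: "w \<in> H j"
        then obtain i m where "i < l" "w = t i m" using H T.surj[of w] by blast
        with w show "w \<in> (\<Union>i<l. t i ` {m. t i m \<in> H j})" by auto
      qed
      ultimately show False using \<open>infinite (H j)\<close> finite_subset by blast
    qed
    then obtain i where i: "i < l" "infinite {m. t i m \<in> H j}" by blast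
    obtain m where m: "\<forall>n\<ge>m. t i n \<in> H j \<longleftrightarrow> t i m \<in> H j" using const[OF j i(1)] by blast
    from i(2) obtain n where "m < n" "t i n \<in> H j" unfolding infinite_nat_iff_unbounded by blast
    with m have "t i m \<in> H j" by (meson less_imp_le)
    with m have "\<forall>n\<ge>m. t i n \<in> H j" by blast
    with i(1) show ?thesis by blast
  qed
  then have "\<exists>\<iota>. \<forall>j\<in>{..<k}. \<iota> j < l \<and> (\<exists>m. \<forall>n\<ge>m. t (\<iota> j) n \<in> H j)"
    by (intro bchoice ballI) auto
  then obtain \<iota> where \<iota>: "\<And>j. j < k \<Longrightarrow> \<iota> j < l"
    and \<iota>_tail: "\<And>j. j < k \<Longrightarrow> \<exists>m. \<forall>n\<ge>m. t (\<iota> j) n \<in> H j" by auto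
  have "inj_on \<iota> {..<k}"
  proof (rule inj_onI)
    fix i j assume ij: "i \<in> {..<k}" "j \<in> {..<k}" "\<iota> i = \<iota> j"
    then obtain a b where "\<forall>n\<ge>a. t (\<iota> j) n \<in> H i" "\<forall>n\<ge>b. t (\<iota> j) n \<in> H j"
      using \<iota>_tail[of i] \<iota>_tail[of j] by auto
    then have "t (\<iota> j) (max a b) \<in> H i \<inter> H j" by simp
    then obtain m n where "t (\<iota> j) (max a b) = h (s i m)" "t (\<iota> j) (max a b) = h (s j n)"
      unfolding H_def by blast
    then have "h (s i m) = h (s j n)" by simp
    moreover have "s i m \<in> \<sigma> - {0}" "s j n \<in> \<sigma> - {0}" using ij S.mem S.nonzero by auto
    ultimately have "s i m = s j n" using h_inj by (auto dest: inj_onD)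
    with ij S.inj show "i = j" by blast
  qed
  moreover have "\<iota> ` {..<k} \<subseteq> {..<l}" using \<iota> by auto
  ultimately have "card {..<k} \<le> card {..<l}" by (intro card_inj_on_le) auto
  then show ?thesis by simp
qed

theorem theorem5p7:
  fixes k l :: nat and \<sigma> \<tau> :: "complex set"
  assumes "k > 0" and "l > 0"
    and "ray_set k \<sigma>" and "ray_set l \<tau>"
  shows "AC_isomorphic \<sigma> \<tau> \<longleftrightarrow> k = l"
proof -
  obtain s C where S: "ray_enumeration k \<sigma> s C" using ray_set_enumeration assms by blast
  obtain t D where T: "ray_enumeration l \<tau> t D" using ray_set_enumeration assms by blast
  interpret S: ray_enumeration k \<sigma> s C by fact
  show ?thesis
  proof
    assume "k = l"
    with S T show "AC_isomorphic \<sigma> \<tau>" by (auto intro: ray_enumeration_isomorphic)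
  next
    assume "AC_isomorphic \<sigma> \<tau>"
    then obtain \<Phi> where bij: "bij_betw \<Phi> (AC \<sigma>) (AC \<tau>)"
      and add: "\<And>f g. f \<in> AC \<sigma> \<Longrightarrow> g \<in> AC \<sigma> \<Longrightarrow> \<Phi> (\<lambda>z. f z + g z) = (\<lambda>z. \<Phi> f z + \<Phi> g z)"
      and scale: "\<And>c f. f \<in> AC \<sigma> \<Longrightarrow> \<Phi> (\<lambda>z. c * f z) = (\<lambda>z. c * \<Phi> f z)"
      and mult: "\<And>f g. f \<in> AC \<sigma> \<Longrightarrow> g \<in> AC \<sigma> \<Longrightarrow> \<Phi> (\<lambda>z. f z * g z) = (\<lambda>z. \<Phi> f z * \<Phi> g z)"
      and cont: "continuous_map (norm_topology (AC \<sigma>) (BV_norm \<sigma>)) (norm_topology (AC \<tau>) (BV_norm \<tau>)) \<Phi>"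
      and cont': "continuous_map (norm_topology (AC \<tau>) (BV_norm \<tau>)) (norm_topology (AC \<sigma>) (BV_norm \<sigma>))
        (inv_into (AC \<sigma>) \<Phi>)"
      unfolding AC_isomorphic_def banach_algebra_isomorphic_def by blast
    have "k \<le> l"
      by (rule ray_enumeration_isomorphic_le[OF S T \<open>0 < l\<close> bij add scale mult cont])
    let ?\<Psi> = "inv_into (AC \<sigma>) \<Phi>"
    have \<Psi>: "?\<Psi> f \<in> AC \<sigma>" "\<Phi> (?\<Psi> f) = f" if "f \<in> AC \<tau>" for f
      using bij_betw_apply[OF bij_betw_inv_into[OF bij] that] bij_betw_inv_into_right[OF bij that] by auto
    have \<Psi>_eq: "?\<Psi> g = f" if "f \<in> AC \<sigma>" "\<Phi> f = g" for f g
      using bij_betw_inv_into_left[OF bij that(1)] that(2) by simp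
    have "l \<le> k"
    proof (rule ray_enumeration_isomorphic_le[OF T S \<open>0 < k\<close> bij_betw_inv_into[OF bij] _ _ _ cont'])
      fix f g assume fg: "f \<in> AC \<tau>" "g \<in> AC \<tau>"
      show "?\<Psi> (\<lambda>z. f z + g z) = (\<lambda>z. ?\<Psi> f z + ?\<Psi> g z)"
        by (rule \<Psi>_eq) (simp_all add: AC_add add \<Psi> fg)
      show "?\<Psi> (\<lambda>z. f z * g z) = (\<lambda>z. ?\<Psi> f z * ?\<Psi> g z)"
        by (rule \<Psi>_eq) (simp_all add: S.AC_mult mult \<Psi> fg)
    next
      fix c f assume f: "f \<in> AC \<tau>"
      show "?\<Psi> (\<lambda>z. c * f z) = (\<lambda>z. c * ?\<Psi> f z)"
        by (rule \<Psi>_eq) (simp_all add: AC_scale scale \<Psi> f)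
    qed
    with \<open>k \<le> l\<close> show "k = l" by simp
  qed
qed

end
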